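(* Let $(E_1,\nabla^1)$ and $(E_2,\nabla^2)$ be a pair of Courant algebroids equipped with Courant algebroid connections. Let $R:E_1\dashrightarrow E_2$ be a Courant algebroid relation supported on $S$. If $\nabla^1\sim_R\nabla^2$, then also $T_{\nabla^1}\sim_RT_{\nabla^2}$, where $T_{\nabla^i}$ is the torsion 3-form of $\nabla^i$.
   Context: A Courant algebroid over a smooth manifold $M$ is a tuple $(E,\rho,\langle\cdot,\cdot\rangle,[\cdot,\cdot])$, where $E\to M$ is a real vector bundle of finite rank, $\rho:E\to TM$ is a vector bundle map over the identity (the anchor), $\langle\cdot,\cdot\rangle$ is a fiber-wise metric on $E$ (symmetric and non-degenerate, of arbitrary but constant signature), and $[\cdot,\cdot]$ is an $\mathbb{R}$-bilinear bracket on $\Gamma(E)$ such that: C1) $[\psi,f\psi']=f[\psi,\psi']+(\mathcal{L}_{\rho(\psi)}f)\psi'$; C2) $[\psi,[\psi',\psi'']]=[[\psi,\psi'],\psi'']+[\psi',[\psi,\psi'']]$; C3) $\mathcal{L}_{\rho(\psi)}\langle\psi',\psi''\rangle=\langle[\psi,\psi'],\psi''\rangle+\langle\psi',[\psi,\psi'']\rangle$; C4) $\langle[\psi,\psi],\psi'\rangle=\frac12\mathcal{L}_{\rho(\psi')}\langle\psi,\psi\rangle$. A subbundle of $E$ supported on an embedded submanifold $S\subseteq M$ is a vector subbundle $L$ of $E_S$; $\Gamma(E;L)=\{\psi\in\Gamma(E)\mid\psi|_S\in\Gamma(L)\}$. An involutive structure supported on $S$ is such an $L$ with $L\subseteq L^\perp$,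 $\rho(L^\perp)\subseteq TS$ and $[\psi,\psi']\in\Gamma(E;L)$ for all $\psi,\psi'\in\Gamma(E;L)$. $\overline{E}$ is $E$ with $\langle\cdot,\cdot\rangle$ replaced by its negative; the product Courant algebroid has componentwise anchor and bracket on pairs of pulled-back sections and the sum of the pulled-back metrics (extended by $C^\infty$-linearity and C1), C4)). A Courant algebroid relation $R:E_1\dashrightarrow E_2$ supported on $S\subseteq M_1\times M_2$ is an involutive structure in $E_1\times\overline{E}_2$ supported on $S$. A Courant algebroid connection on $E$ is an $\mathbb{R}$-bilinear map $\nabla:\Gamma(E)\times\Gamma(E)\to\Gamma(E)$, $\nabla_\psi\psi'=\nabla(\psi,\psi')$, with $\nabla_{f\psi}\psi'=f\nabla_\psi\psi'$, $\nabla_\psi(f\psi')=f\nabla_\psi\psi'+(\mathcal{L}_{\rho(\psi)}f)\psi'$ and $\mathcal{L}_{\rho(\psi)}\langle\psi',\psi''\rangle=\langle\nabla_\psi\psi',\psi''\rangle+\langle\psi',\nabla_\psi\psi''\rangle$. Its torsion 3-form is $T_\nabla(\psi,\psi',\psi'')=\langle\nabla_\psi\psi'-\nabla_{\psi'}\psi-[\psi,\psi'],\psi''\rangle+\langle\nabla_{\psi''}\psi,\psi'\rangle$ (it is $C^\infty$-multilinear and completely skew-symmetric). The connections $\nabla^1,\nabla^2$ define a connection $\nabla$ on $E_1\times\overline{E}_2$ by $\nabla_{(\psi_1,\psi_2)}(\phi_1,\phi_2)=(\nabla^1_{\psi_1}\phi_1,\nabla^2_{\psi_2}\phi_2)$ on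 pairs of pulled-back sections, extended by the Leibniz rules. $\nabla^1\sim_R\nabla^2$ means $\nabla_\psi\psi'\in\Gamma(E_1\times\overline{E}_2;R)$ for all $\psi,\psi'\in\Gamma(E_1\times\overline{E}_2;R)$. Covariant $k$-tensors $t_1$ on $E_1$ and $t_2$ on $E_2$ are $R$-related, $t_1\sim_Rt_2$, if $(t_1)_{s_1}(e_1^{(1)},\dots,e_1^{(k)})=(t_2)_{s_2}(e_2^{(1)},\dots,e_2^{(k)})$ for all $(s_1,s_2)\in S$ and all $(e_1^{(i)},e_2^{(i)})\in R_{(s_1,s_2)}$, $i=1,\dots,k$. *)

theory Defs
  imports "HOL-Analysis.Analysis"
begin

section \<open>Smooth functions\<close>

text \<open>\<open>Ck_on k U f\<close>, for an open set \<open>U\<close>: \<open>f\<close> is \<open>k\<close> times continuously differentiable on \<open>U\<close>.\<close>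

primrec Ck_on ::
  "nat \<Rightarrow> 'e::euclidean_space set \<Rightarrow> ('e \<Rightarrow> 'f::real_normed_vector) \<Rightarrow> bool" where
  "Ck_on 0 U f \<longleftrightarrow> continuous_on U f"
| "Ck_on (Suc k) U f \<longleftrightarrow>
     (\<forall>x\<in>U. f differentiable (at x)) \<and>
     (\<forall>v. Ck_on k U (\<lambda>x. frechet_derivative f (at x) v))"

text \<open>On an arbitrary subset of a Euclidean space, a function is smooth if it extends locally to
  a smooth function on an open set. On a relatively open subset of a linear
  subspace this is ordinary smoothness of a function on an open subset of that vector space.\<close>

definition smooth_on ::
  "'e::euclidean_space set \<Rightarrow> ('e \<Rightarrow> 'f::real_normed_vector) \<Rightarrow> bool" where
  "smooth_on A f \<longleftrightarrow>
     (\<forall>x\<in>A. \<exists>U g. open U \<and> x \<in> U \<and> (\<forall>k. Ck_on k U g) \<and> (\<forall>y\<in>A \<inter> U. g y = f y))"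


section \<open>Smooth manifolds\<close>

text \<open>The points of a manifold form a whole type \<open>'a\<close>, whose topology is Hausdorff and second
  countable. Charts take values in a linear subspace \<open>model\<close> of the Euclidean space \<open>'e\<close>; the
  dimension of the manifold is \<open>dim model\<close>. Allowing a proper subspace (every type of class
  \<open>euclidean_space\<close> has positive dimension) includes manifolds of dimension \<open>0\<close>.\<close>

record ('a, 'e) smooth_structure =
  model :: "'e set"
  atlas :: "('a set \<times> ('a \<Rightarrow> 'e)) set"

definition is_chart ::
  "('a::topological_space, 'e::euclidean_space) smooth_structure \<Rightarrow> 'a set \<times> ('a \<Rightarrow> 'e) \<Rightarrow> bool" where
  "is_chart M = (\<lambda>(U, \<phi>). open U \<and> openin (top_of_set (model M)) (\<phi> ` U) \<and>
     homeomorphism U (\<phi> ` U) \<phi> (inv_into U \<phi>))"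

definition smooth_transition ::
  "'a set \<times> ('a \<Rightarrow> 'e::euclidean_space) \<Rightarrow> 'a set \<times> ('a \<Rightarrow> 'e) \<Rightarrow> bool" where
  "smooth_transition = (\<lambda>(U, \<phi>) (V, \<psi>). smooth_on (\<phi> ` (U \<inter> V)) (\<psi> \<circ> inv_into U \<phi>))"

definition smooth_manifold ::
  "('a::{t2_space, second_countable_topology}, 'e::euclidean_space) smooth_structure \<Rightarrow> bool" where
  "smooth_manifold M \<longleftrightarrow>
     subspace (model M) \<and>
     (\<forall>c\<in>atlas M. is_chart M c) \<and>
     (\<Union>c\<in>atlas M. fst c) = UNIV \<and>
     (\<forall>c\<in>atlas M. \<forall>c'\<in>atlas M. smooth_transition c c')"

text \<open>The charts of the maximal atlas.\<close>

definition smooth_chart ::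
  "('a::topological_space, 'e::euclidean_space) smooth_structure \<Rightarrow> 'a set \<times> ('a \<Rightarrow> 'e) \<Rightarrow> bool" where
  "smooth_chart M c \<longleftrightarrow>
     is_chart M c \<and> (\<forall>c'\<in>atlas M. smooth_transition c c' \<and> smooth_transition c' c)"

text \<open>Smooth functions on a subset \<open>A\<close> of the manifold. This is used for open \<open>A\<close> and for relatively
  open subsets \<open>A\<close> of an embedded submanifold \<open>S\<close>; in the latter case it agrees with
  smoothness for the manifold structure of \<open>S\<close>.\<close>

definition smooth_fun_on ::
  "('a, 'e::euclidean_space) smooth_structure \<Rightarrow> 'a set \<Rightarrow> ('a \<Rightarrow> real) \<Rightarrow> bool" where
  "smooth_fun_on M A f \<longleftrightarrow>
     (\<forall>(U, \<phi>)\<in>atlas M. smooth_on (\<phi> ` (A \<inter> U)) (f \<circ> inv_into U \<phi>))"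

abbreviation smooth_fun ::
  "('a, 'e::euclidean_space) smooth_structure \<Rightarrow> ('a \<Rightarrow> real) \<Rightarrow> bool" where
  "smooth_fun M \<equiv> smooth_fun_on M UNIV"

definition embedded_submanifold ::
  "('a::topological_space, 'e::euclidean_space) smooth_structure \<Rightarrow> 'a set \<Rightarrow> bool" where
  "embedded_submanifold M S \<longleftrightarrow>
     (\<exists>d. \<forall>x\<in>S. \<exists>U \<phi> W. smooth_chart M (U, \<phi>) \<and> x \<in> U \<and>
        subspace W \<and> W \<subseteq> model M \<and> dim W = d \<and> \<phi> ` (U \<inter> S) = \<phi> ` U \<inter> W)"

text \<open>Tangent vectors at \<open>x\<close> are derivations at \<open>x\<close> of the algebra of smooth functions on \<open>A\<close>, where
  \<open>A\<close> is the whole manifold or an embedded submanifold. The values of a derivation on non-smooth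
  functions are irrelevant.\<close>

definition tangent_vectors ::
  "('a, 'e::euclidean_space) smooth_structure \<Rightarrow> 'a set \<Rightarrow> 'a \<Rightarrow> (('a \<Rightarrow> real) \<Rightarrow> real) set" where
  "tangent_vectors M A x = {D.
     \<forall>f g. smooth_fun_on M A f \<longrightarrow> smooth_fun_on M A g \<longrightarrow>
       (\<forall>a b. D (\<lambda>y. a * f y + b * g y) = a * D f + b * D g) \<and>
       D (\<lambda>y. f y * g y) = D f * g x + f x * D g}"

text \<open>A tangent vector \<open>D\<close> of \<open>M\<close> at \<open>x \<in> S\<close> lies in \<open>T\<^sub>x S\<close> if it is the image of a tangent vector
  of \<open>S\<close> under the differential of the inclusion; the pullback of a function along the inclusion is
  the same function, regarded as a function on \<open>S\<close>.\<close>

definition tangent_to ::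
  "('a, 'e::euclidean_space) smooth_structure \<Rightarrow> 'a set \<Rightarrow> 'a \<Rightarrow> (('a \<Rightarrow> real) \<Rightarrow> real) \<Rightarrow> bool" where
  "tangent_to M S x D \<longleftrightarrow>
     (\<exists>D'\<in>tangent_vectors M S x. \<forall>f. smooth_fun M f \<longrightarrow> D f = D' f)"

definition product_structure ::
  "('a, 'e) smooth_structure \<Rightarrow> ('b, 'f) smooth_structure \<Rightarrow>
   ('a \<times> 'b, 'e \<times> 'f) smooth_structure" where
  "product_structure M N =
     \<lparr>model = model M \<times> model N,
      atlas = {(U \<times> V, map_prod \<phi> \<psi>) | U \<phi> V \<psi>. (U, \<phi>) \<in> atlas M \<and> (V, \<psi>) \<in> atlas N}\<rparr>"


section \<open>Vector bundles with a fibre-wise metric and an anchor\<close>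

definition basis_of :: "nat \<Rightarrow> (nat \<Rightarrow> 'v::real_vector) \<Rightarrow> 'v set \<Rightarrow> bool" where
  "basis_of k b V \<longleftrightarrow>
     inj_on b {..<k} \<and> independent (b ` {..<k}) \<and> span (b ` {..<k}) = V"

text \<open>The fibres of a bundle over \<open>'a\<close> are linear subspaces of one real vector space \<open>'v\<close>, which
  carries no further structure. The smooth structure of the bundle is given by local trivializations,
  encoded as the local frames which they determine: the pair \<open>(U, s)\<close> consists of an open set
  \<open>U\<close> and the frame \<open>s 0, \<dots>, s (rank - 1)\<close> over \<open>U\<close>. The action of the anchor is recorded as
  \<open>anchor E x e f\<close>, the derivative of the function \<open>f\<close> along the tangent vector \<open>\<rho>(e)\<close> at \<open>x\<close>.\<close>

record ('a, 'e, 'v) metric_bundle =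
  base :: "('a, 'e) smooth_structure"
  bundle_rank :: nat
  fibre :: "'a \<Rightarrow> 'v set"
  local_frames :: "('a set \<times> (nat \<Rightarrow> 'a \<Rightarrow> 'v)) set"
  anchor :: "'a \<Rightarrow> 'v \<Rightarrow> ('a \<Rightarrow> real) \<Rightarrow> real"
  metric :: "'a \<Rightarrow> 'v \<Rightarrow> 'v \<Rightarrow> real"

definition vector_bundle ::
  "('a::topological_space, 'e::euclidean_space, 'v::real_vector) metric_bundle \<Rightarrow> bool" where
  "vector_bundle E \<longleftrightarrow>
     (\<forall>(U, s)\<in>local_frames E. open U \<and>
        (\<forall>x\<in>U. basis_of (bundle_rank E) (\<lambda>i. s i x) (fibre E x))) \<and>
     (\<Union>c\<in>local_frames E. fst c) = UNIV \<and>
     (\<forall>(U, s)\<in>local_frames E. \<forall>(V, t)\<in>local_frames E.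
        \<exists>g. (\<forall>i<bundle_rank E. \<forall>j<bundle_rank E. smooth_fun_on (base E) (U \<inter> V) (g i j)) \<and>
            (\<forall>j<bundle_rank E. \<forall>x\<in>U \<inter> V. t j x = (\<Sum>i<bundle_rank E. g i j x *\<^sub>R s i x)))"

definition smooth_section_on ::
  "('a, 'e::euclidean_space, 'v::real_vector) metric_bundle \<Rightarrow> 'a set \<Rightarrow> ('a \<Rightarrow> 'v) \<Rightarrow> bool" where
  "smooth_section_on E A \<sigma> \<longleftrightarrow>
     (\<forall>x\<in>A. \<sigma> x \<in> fibre E x) \<and>
     (\<forall>(U, s)\<in>local_frames E.
        \<exists>c. (\<forall>i<bundle_rank E. smooth_fun_on (base E) (A \<inter> U) (c i)) \<and>
            (\<forall>x\<in>A \<inter> U. \<sigma> x = (\<Sum>i<bundle_rank E. c i x *\<^sub>R s i x)))"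

definition sections ::
  "('a, 'e::euclidean_space, 'v::real_vector) metric_bundle \<Rightarrow> ('a \<Rightarrow> 'v) set" where
  "sections E = {\<psi>. smooth_section_on E UNIV \<psi>}"

definition is_anchor ::
  "('a, 'e::euclidean_space, 'v::real_vector) metric_bundle \<Rightarrow> bool" where
  "is_anchor E \<longleftrightarrow>
     (\<forall>x. \<forall>e\<in>fibre E x. anchor E x e \<in> tangent_vectors (base E) UNIV x) \<and>
     (\<forall>x. \<forall>e\<in>fibre E x. \<forall>e'\<in>fibre E x. \<forall>a b f. smooth_fun (base E) f \<longrightarrow>
        anchor E x (a *\<^sub>R e + b *\<^sub>R e') f = a * anchor E x e f + b * anchor E x e' f) \<and>
     (\<forall>\<psi>\<in>sections E. \<forall>f. smooth_fun (base E) f \<longrightarrow>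
        smooth_fun (base E) (\<lambda>x. anchor E x (\<psi> x) f))"

text \<open>The last clause says that the signature is \<open>(p, rank - p)\<close> at every point.\<close>

definition is_metric ::
  "('a, 'e::euclidean_space, 'v::real_vector) metric_bundle \<Rightarrow> bool" where
  "is_metric E \<longleftrightarrow>
     (\<forall>x. \<forall>u\<in>fibre E x. \<forall>v\<in>fibre E x. \<forall>w\<in>fibre E x. \<forall>a b.
        metric E x (a *\<^sub>R u + b *\<^sub>R v) w = a * metric E x u w + b * metric E x v w) \<and>
     (\<forall>x. \<forall>u\<in>fibre E x. \<forall>v\<in>fibre E x. metric E x u v = metric E x v u) \<and>
     (\<forall>x. \<forall>u\<in>fibre E x. (\<forall>v\<in>fibre E x. metric E x u v = 0) \<longrightarrow> u = 0) \<and>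
     (\<forall>\<psi>\<in>sections E. \<forall>\<phi>\<in>sections E. smooth_fun (base E) (\<lambda>x. metric E x (\<psi> x) (\<phi> x))) \<and>
     (\<exists>p. \<forall>x. \<exists>b. basis_of (bundle_rank E) b (fibre E x) \<and>
        (\<forall>i<bundle_rank E. \<forall>j<bundle_rank E.
           metric E x (b i) (b j) = (if i = j then (if i < p then 1 else - 1) else 0)))"

definition opposite :: "('a, 'e, 'v) metric_bundle \<Rightarrow> ('a, 'e, 'v) metric_bundle" where
  "opposite E = E\<lparr>metric := \<lambda>x u v. - metric E x u v\<rparr>"

text \<open>The anchor uses \<open>T(M \<times> N) = TM \<times> TN\<close>: the derivation defined by a pair of tangent vectors
  differentiates in each variable separately.\<close>

definition product_bundle ::
  "('a, 'e, 'v::real_vector) metric_bundle \<Rightarrow> ('b, 'f, 'w::real_vector) metric_bundle \<Rightarrow>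
   ('a \<times> 'b, 'e \<times> 'f, 'v \<times> 'w) metric_bundle" where
  "product_bundle E F =
     \<lparr>base = product_structure (base E) (base F),
      bundle_rank = bundle_rank E + bundle_rank F,
      fibre = (\<lambda>(x, y). fibre E x \<times> fibre F y),
      local_frames = {(U \<times> V, \<lambda>i (x, y). if i < bundle_rank E then (s i x, 0)
                                          else (0, t (i - bundle_rank E) y)) | U s V t.
                       (U, s) \<in> local_frames E \<and> (V, t) \<in> local_frames F},
      anchor = (\<lambda>(x, y) (u, v) f. anchor E x u (\<lambda>x'. f (x', y)) + anchor F y v (\<lambda>y'. f (x, y'))),
      metric = (\<lambda>(x, y) (u, v) (u', v'). metric E x u u' + metric F y v v')\<rparr>"


section \<open>Courant algebroids\<close>

definition courant_algebroid ::
  "('a::{t2_space, second_countable_topology}, 'e::euclidean_space, 'v::real_vector) metric_bundle \<Rightarrow>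
   (('a \<Rightarrow> 'v) \<Rightarrow> ('a \<Rightarrow> 'v) \<Rightarrow> 'a \<Rightarrow> 'v) \<Rightarrow> bool" where
  "courant_algebroid E br \<longleftrightarrow>
     smooth_manifold (base E) \<and> vector_bundle E \<and> is_anchor E \<and> is_metric E \<and>
     (\<forall>\<psi>\<in>sections E. \<forall>\<phi>\<in>sections E. br \<psi> \<phi> \<in> sections E) \<and>
     (\<forall>\<psi>\<in>sections E. \<forall>\<phi>\<in>sections E. \<forall>\<xi>\<in>sections E. \<forall>a b.
        br (\<lambda>x. a *\<^sub>R \<psi> x + b *\<^sub>R \<phi> x) \<xi> = (\<lambda>x. a *\<^sub>R br \<psi> \<xi> x + b *\<^sub>R br \<phi> \<xi> x) \<and>
        br \<xi> (\<lambda>x. a *\<^sub>R \<psi> x + b *\<^sub>R \<phi> x) = (\<lambda>x. a *\<^sub>R br \<xi> \<psi> x + b *\<^sub>R br \<xi> \<phi> x)) \<and>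
     (\<forall>\<psi>\<in>sections E. \<forall>\<phi>\<in>sections E. \<forall>f. smooth_fun (base E) f \<longrightarrow>
        br \<psi> (\<lambda>x. f x *\<^sub>R \<phi> x) = (\<lambda>x. f x *\<^sub>R br \<psi> \<phi> x + anchor E x (\<psi> x) f *\<^sub>R \<phi> x)) \<and>
     (\<forall>\<psi>\<in>sections E. \<forall>\<phi>\<in>sections E. \<forall>\<xi>\<in>sections E.
        br \<psi> (br \<phi> \<xi>) = (\<lambda>x. br (br \<psi> \<phi>) \<xi> x + br \<phi> (br \<psi> \<xi>) x)) \<and>
     (\<forall>\<psi>\<in>sections E. \<forall>\<phi>\<in>sections E. \<forall>\<xi>\<in>sections E. \<forall>x.
        anchor E x (\<psi> x) (\<lambda>y. metric E y (\<phi> y) (\<xi> y)) =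
          metric E x (br \<psi> \<phi> x) (\<xi> x) + metric E x (\<phi> x) (br \<psi> \<xi> x)) \<and>
     (\<forall>\<psi>\<in>sections E. \<forall>\<phi>\<in>sections E. \<forall>x.
        metric E x (br \<psi> \<psi> x) (\<phi> x) =
          1 / 2 * anchor E x (\<phi> x) (\<lambda>y. metric E y (\<psi> y) (\<psi> y)))"

text \<open>The section of a product bundle given by a pair of pulled-back sections.\<close>

definition section_pair :: "('a \<Rightarrow> 'v) \<Rightarrow> ('b \<Rightarrow> 'w) \<Rightarrow> 'a \<times> 'b \<Rightarrow> 'v \<times> 'w" where
  "section_pair \<psi>1 \<psi>2 = (\<lambda>(x, y). (\<psi>1 x, \<psi>2 y))"

text \<open>\<open>br\<close> is the bracket of the product Courant algebroid of \<open>(E, brE)\<close> and \<open>(F, brF)\<close>. Pairs of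
  pulled-back sections locally generate all sections, so there is exactly one such bracket, up to
  its values on functions that are not sections.\<close>

definition is_product_bracket ::
  "('a::{t2_space, second_countable_topology}, 'e::euclidean_space, 'v::real_vector) metric_bundle \<Rightarrow>
   (('a \<Rightarrow> 'v) \<Rightarrow> ('a \<Rightarrow> 'v) \<Rightarrow> 'a \<Rightarrow> 'v) \<Rightarrow>
   ('b::{t2_space, second_countable_topology}, 'f::euclidean_space, 'w::real_vector) metric_bundle \<Rightarrow>
   (('b \<Rightarrow> 'w) \<Rightarrow> ('b \<Rightarrow> 'w) \<Rightarrow> 'b \<Rightarrow> 'w) \<Rightarrow>
   (('a \<times> 'b \<Rightarrow> 'v \<times> 'w) \<Rightarrow> ('a \<times> 'b \<Rightarrow> 'v \<times> 'w) \<Rightarrow> 'a \<times> 'b \<Rightarrow> 'v \<times> 'w) \<Rightarrow> bool" where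
  "is_product_bracket E brE F brF br \<longleftrightarrow>
     courant_algebroid (product_bundle E F) br \<and>
     (\<forall>\<psi>1\<in>sections E. \<forall>\<phi>1\<in>sections E. \<forall>\<psi>2\<in>sections F. \<forall>\<phi>2\<in>sections F.
        br (section_pair \<psi>1 \<psi>2) (section_pair \<phi>1 \<phi>2) =
          section_pair (brE \<psi>1 \<phi>1) (brF \<psi>2 \<phi>2))"


section \<open>Involutive structures and Courant algebroid relations\<close>

definition subbundle ::
  "('a::topological_space, 'e::euclidean_space, 'v::real_vector) metric_bundle \<Rightarrow>
   'a set \<Rightarrow> ('a \<Rightarrow> 'v set) \<Rightarrow> bool" where
  "subbundle E S L \<longleftrightarrow>
     embedded_submanifold (base E) S \<and>
     (\<exists>r. \<forall>x\<in>S. \<exists>U s. open U \<and> x \<in> U \<and>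
        (\<forall>i<r. smooth_section_on E (S \<inter> U) (s i)) \<and>
        (\<forall>y\<in>S \<inter> U. basis_of r (\<lambda>i. s i y) (L y)))"

definition sections_in ::
  "('a, 'e::euclidean_space, 'v::real_vector) metric_bundle \<Rightarrow> 'a set \<Rightarrow> ('a \<Rightarrow> 'v set) \<Rightarrow>
   ('a \<Rightarrow> 'v) set" where
  "sections_in E S L = {\<psi>\<in>sections E. \<forall>x\<in>S. \<psi> x \<in> L x}"

definition orthogonal_complement ::
  "('a, 'e, 'v) metric_bundle \<Rightarrow> ('a \<Rightarrow> 'v set) \<Rightarrow> 'a \<Rightarrow> 'v set" where
  "orthogonal_complement E L x = {v\<in>fibre E x. \<forall>u\<in>L x. metric E x v u = 0}"

definition involutive_structure ::
  "('a::topological_space, 'e::euclidean_space, 'v::real_vector) metric_bundle \<Rightarrow>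
   (('a \<Rightarrow> 'v) \<Rightarrow> ('a \<Rightarrow> 'v) \<Rightarrow> 'a \<Rightarrow> 'v) \<Rightarrow> 'a set \<Rightarrow> ('a \<Rightarrow> 'v set) \<Rightarrow> bool" where
  "involutive_structure E br S L \<longleftrightarrow>
     subbundle E S L \<and>
     (\<forall>x\<in>S. L x \<subseteq> orthogonal_complement E L x) \<and>
     (\<forall>x\<in>S. \<forall>v\<in>orthogonal_complement E L x. tangent_to (base E) S x (anchor E x v)) \<and>
     (\<forall>\<psi>\<in>sections_in E S L. \<forall>\<phi>\<in>sections_in E S L. br \<psi> \<phi> \<in> sections_in E S L)"

definition courant_relation ::
  "('a::{t2_space, second_countable_topology}, 'e::euclidean_space, 'v::real_vector) metric_bundle \<Rightarrow>
   (('a \<Rightarrow> 'v) \<Rightarrow> ('a \<Rightarrow> 'v) \<Rightarrow> 'a \<Rightarrow> 'v) \<Rightarrow>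
   ('b::{t2_space, second_countable_topology}, 'f::euclidean_space, 'w::real_vector) metric_bundle \<Rightarrow>
   (('b \<Rightarrow> 'w) \<Rightarrow> ('b \<Rightarrow> 'w) \<Rightarrow> 'b \<Rightarrow> 'w) \<Rightarrow>
   ('a \<times> 'b) set \<Rightarrow> ('a \<times> 'b \<Rightarrow> ('v \<times> 'w) set) \<Rightarrow> bool" where
  "courant_relation E1 br1 E2 br2 S R \<longleftrightarrow>
     (\<exists>br. is_product_bracket E1 br1 (opposite E2) br2 br \<and>
           involutive_structure (product_bundle E1 (opposite E2)) br S R)"


section \<open>Courant algebroid connections and torsion\<close>

text \<open>The bracket does not enter the definition of a connection.\<close>

definition courant_connection ::
  "('a, 'e::euclidean_space, 'v::real_vector) metric_bundle \<Rightarrow>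
   (('a \<Rightarrow> 'v) \<Rightarrow> ('a \<Rightarrow> 'v) \<Rightarrow> 'a \<Rightarrow> 'v) \<Rightarrow> bool" where
  "courant_connection E nab \<longleftrightarrow>
     (\<forall>\<psi>\<in>sections E. \<forall>\<phi>\<in>sections E. nab \<psi> \<phi> \<in> sections E) \<and>
     (\<forall>\<psi>\<in>sections E. \<forall>\<phi>\<in>sections E. \<forall>\<xi>\<in>sections E. \<forall>a b.
        nab (\<lambda>x. a *\<^sub>R \<psi> x + b *\<^sub>R \<phi> x) \<xi> = (\<lambda>x. a *\<^sub>R nab \<psi> \<xi> x + b *\<^sub>R nab \<phi> \<xi> x) \<and>
        nab \<xi> (\<lambda>x. a *\<^sub>R \<psi> x + b *\<^sub>R \<phi> x) = (\<lambda>x. a *\<^sub>R nab \<xi> \<psi> x + b *\<^sub>R nab \<xi> \<phi> x)) \<and>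
     (\<forall>\<psi>\<in>sections E. \<forall>\<phi>\<in>sections E. \<forall>f. smooth_fun (base E) f \<longrightarrow>
        nab (\<lambda>x. f x *\<^sub>R \<psi> x) \<phi> = (\<lambda>x. f x *\<^sub>R nab \<psi> \<phi> x) \<and>
        nab \<psi> (\<lambda>x. f x *\<^sub>R \<phi> x) = (\<lambda>x. f x *\<^sub>R nab \<psi> \<phi> x + anchor E x (\<psi> x) f *\<^sub>R \<phi> x)) \<and>
     (\<forall>\<psi>\<in>sections E. \<forall>\<phi>\<in>sections E. \<forall>\<xi>\<in>sections E. \<forall>x.
        anchor E x (\<psi> x) (\<lambda>y. metric E y (\<phi> y) (\<xi> y)) =
          metric E x (nab \<psi> \<phi> x) (\<xi> x) + metric E x (\<phi> x) (nab \<psi> \<xi> x))"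

text \<open>As for brackets, the values on pairs of pulled-back sections determine the connection.\<close>

definition is_product_connection ::
  "('a, 'e::euclidean_space, 'v::real_vector) metric_bundle \<Rightarrow>
   (('a \<Rightarrow> 'v) \<Rightarrow> ('a \<Rightarrow> 'v) \<Rightarrow> 'a \<Rightarrow> 'v) \<Rightarrow>
   ('b, 'f::euclidean_space, 'w::real_vector) metric_bundle \<Rightarrow>
   (('b \<Rightarrow> 'w) \<Rightarrow> ('b \<Rightarrow> 'w) \<Rightarrow> 'b \<Rightarrow> 'w) \<Rightarrow>
   (('a \<times> 'b \<Rightarrow> 'v \<times> 'w) \<Rightarrow> ('a \<times> 'b \<Rightarrow> 'v \<times> 'w) \<Rightarrow> 'a \<times> 'b \<Rightarrow> 'v \<times> 'w) \<Rightarrow> bool" where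
  "is_product_connection E nabE F nabF nab \<longleftrightarrow>
     courant_connection (product_bundle E F) nab \<and>
     (\<forall>\<psi>1\<in>sections E. \<forall>\<phi>1\<in>sections E. \<forall>\<psi>2\<in>sections F. \<forall>\<phi>2\<in>sections F.
        nab (section_pair \<psi>1 \<psi>2) (section_pair \<phi>1 \<phi>2) =
          section_pair (nabE \<psi>1 \<phi>1) (nabF \<psi>2 \<phi>2))"

definition connections_related ::
  "('a, 'e::euclidean_space, 'v::real_vector) metric_bundle \<Rightarrow>
   (('a \<Rightarrow> 'v) \<Rightarrow> ('a \<Rightarrow> 'v) \<Rightarrow> 'a \<Rightarrow> 'v) \<Rightarrow>
   ('b, 'f::euclidean_space, 'w::real_vector) metric_bundle \<Rightarrow>
   (('b \<Rightarrow> 'w) \<Rightarrow> ('b \<Rightarrow> 'w) \<Rightarrow> 'b \<Rightarrow> 'w) \<Rightarrow>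
   ('a \<times> 'b) set \<Rightarrow> ('a \<times> 'b \<Rightarrow> ('v \<times> 'w) set) \<Rightarrow> bool" where
  "connections_related E1 nab1 E2 nab2 S R \<longleftrightarrow>
     (\<exists>nab. is_product_connection E1 nab1 (opposite E2) nab2 nab \<and>
        (\<forall>\<psi>\<in>sections_in (product_bundle E1 (opposite E2)) S R.
         \<forall>\<phi>\<in>sections_in (product_bundle E1 (opposite E2)) S R.
           nab \<psi> \<phi> \<in> sections_in (product_bundle E1 (opposite E2)) S R))"

definition torsion_form ::
  "('a, 'e, 'v::real_vector) metric_bundle \<Rightarrow>
   (('a \<Rightarrow> 'v) \<Rightarrow> ('a \<Rightarrow> 'v) \<Rightarrow> 'a \<Rightarrow> 'v) \<Rightarrow>
   (('a \<Rightarrow> 'v) \<Rightarrow> ('a \<Rightarrow> 'v) \<Rightarrow> 'a \<Rightarrow> 'v) \<Rightarrow>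
   ('a \<Rightarrow> 'v) \<Rightarrow> ('a \<Rightarrow> 'v) \<Rightarrow> ('a \<Rightarrow> 'v) \<Rightarrow> 'a \<Rightarrow> real" where
  "torsion_form E br nab \<psi> \<phi> \<xi> = (\<lambda>x.
     metric E x (nab \<psi> \<phi> x - nab \<phi> \<psi> x - br \<psi> \<phi> x) (\<xi> x) + metric E x (nab \<xi> \<psi> x) (\<phi> x))"

text \<open>The tensor given by a \<open>C\<^sup>\<infinity>\<close>-multilinear map of sections: its value on vectors in the fibre
  over \<open>x\<close> is the common value at \<open>x\<close> of the map on all sections extending these vectors.\<close>

definition tensor_of ::
  "('a, 'e::euclidean_space, 'v::real_vector) metric_bundle \<Rightarrow>
   (('a \<Rightarrow> 'v) \<Rightarrow> ('a \<Rightarrow> 'v) \<Rightarrow> ('a \<Rightarrow> 'v) \<Rightarrow> 'a \<Rightarrow> real) \<Rightarrow> 'a \<Rightarrow> 'v \<Rightarrow> 'v \<Rightarrow> 'v \<Rightarrow> real" where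
  "tensor_of E T x u v w = (THE r. \<forall>\<psi>\<in>sections E. \<forall>\<phi>\<in>sections E. \<forall>\<xi>\<in>sections E.
     \<psi> x = u \<longrightarrow> \<phi> x = v \<longrightarrow> \<xi> x = w \<longrightarrow> T \<psi> \<phi> \<xi> x = r)"

text \<open>Relatedness of covariant \<open>3\<close>-tensors.\<close>

definition tensors_related ::
  "('a \<times> 'b) set \<Rightarrow> ('a \<times> 'b \<Rightarrow> ('v \<times> 'w) set) \<Rightarrow>
   ('a \<Rightarrow> 'v \<Rightarrow> 'v \<Rightarrow> 'v \<Rightarrow> real) \<Rightarrow> ('b \<Rightarrow> 'w \<Rightarrow> 'w \<Rightarrow> 'w \<Rightarrow> real) \<Rightarrow> bool" where
  "tensors_related S R t1 t2 \<longleftrightarrow>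
     (\<forall>(x, y)\<in>S. \<forall>(u, u')\<in>R (x, y). \<forall>(v, v')\<in>R (x, y). \<forall>(w, w')\<in>R (x, y).
        t1 x u v w = t2 y u' v' w')"

end

theory Submission
  imports Defs
begin

text \<open>
  Let \<open>E\<close> be the product of \<open>E\<^sub>1\<close> with the opposite of \<open>E\<^sub>2\<close>, and \<open>T\<close> the torsion form of the product
  connection. On pairs of pulled-back sections \<open>T\<close> is the difference of the two torsion forms,
  because anchor, bracket and connection are componentwise and the metric of \<open>E\<^sub>2\<close> enters with the
  opposite sign (\<open>torsion_form_section_pair\<close>). On sections that lie in \<open>R\<close> over \<open>S\<close>, \<open>T\<close> vanishes at
  the points of \<open>S\<close>: bracket and connection do not leave the space of such sections, and \<open>R\<close> is
  isotropic, so each metric term is zero (\<open>torsion_vanishes\<close>).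

  The two descriptions are about different sections, since a pair of pulled-back sections need not lie
  in \<open>R\<close> along \<open>S\<close>. They are compared through values at a point: given vectors \<open>(u, u')\<close> of \<open>R\<close> over
  \<open>(x, y) \<in> S\<close>, one extension is a pair of sections through \<open>u\<close> and \<open>u'\<close> (\<open>section_through\<close>), another
  is a section lying in \<open>R\<close> (\<open>section_in_subbundle\<close>), and tensoriality of the torsion
  (\<open>torsion_pointwise\<close>) makes \<open>T\<close> agree on them.

  Tensoriality has an algebraic half, the cancellation of all derivative terms when an argument is
  multiplied by a function (\<open>torsion_scale\<close>), and an analytic half: a map of global sections that is
  linear over smooth functions depends on values at a point only (\<open>pointwise_if_Cinf_linear\<close>). The
  analytic half and both extension lemmas rest on smooth bump functions, hence on
  \<open>t \<mapsto> exp (- 1 / t)\<close> and on the chain rule for functions in the class \<open>Ck_on k\<close>.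
\<close>

section \<open>Continuously differentiable functions\<close>

declare Ck_on.simps [simp del]

lemma Ck_on_subset: "Ck_on k U f \<Longrightarrow> V \<subseteq> U \<Longrightarrow> Ck_on k V f"
  by (induction k arbitrary: f) (auto simp: Ck_on.simps intro: continuous_on_subset)

lemma Ck_on_cong:
  assumes "open U" "\<And>x. x \<in> U \<Longrightarrow> f x = g x"
  shows "Ck_on k U f \<longleftrightarrow> Ck_on k U g"
proof -
  have *: "Ck_on k U g" if "Ck_on k U f" "\<And>x. x \<in> U \<Longrightarrow> f x = g x" for f g
    using that
  proof (induction k arbitrary: f g)
    case 0
    then show ?case by (simp add: Ck_on.simps(1) cong: continuous_on_cong)
  next
    case (Suc k)
    have d: "(g has_derivative frechet_derivative f (at x)) (at x)" if "x \<in> U" for x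
    proof (rule has_derivative_transform_within_open[OF _ assms(1) that])
      show "(f has_derivative frechet_derivative f (at x)) (at x)"
        using Suc.prems(1) that by (simp add: Ck_on.simps(2) frechet_derivative_works)
    qed (use Suc.prems(2) in simp)
    show ?case
      unfolding Ck_on.simps(2)
    proof (intro conjI ballI allI)
      show "g differentiable at x" if "x \<in> U" for x
        using d[OF that] by (rule differentiableI)
      show "Ck_on k U (\<lambda>x. frechet_derivative g (at x) v)" for v
      proof (rule Suc.IH)
        show "Ck_on k U (\<lambda>x. frechet_derivative f (at x) v)"
          using Suc.prems(1) unfolding Ck_on.simps(2) by (elim conjE) (erule spec)
        show "frechet_derivative f (at x) v = frechet_derivative g (at x) v" if "x \<in> U" for x
          using frechet_derivative_at[OF d[OF that]] by (rule fun_cong)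
      qed
    qed
  qed
  show ?thesis using *[of f g] *[of g f] assms(2) by auto
qed

lemma Ck_on_SucI:
  assumes "open U"
    and "\<And>x. x \<in> U \<Longrightarrow> (f has_derivative f' x) (at x)"
    and "\<And>v. Ck_on k U (\<lambda>x. f' x v)"
  shows "Ck_on (Suc k) U f"
  unfolding Ck_on.simps(2)
proof (intro conjI ballI allI)
  show "f differentiable at x" if "x \<in> U" for x
    using assms(2)[OF that] by (rule differentiableI)
  show "Ck_on k U (\<lambda>x. frechet_derivative f (at x) v)" for v
  proof (rule Ck_on_cong[OF assms(1), THEN iffD1, OF _ assms(3)])
    show "f' x v = frechet_derivative f (at x) v" if "x \<in> U" for x
      using frechet_derivative_at[OF assms(2)[OF that]] by (rule fun_cong)
  qed
qed

lemma Ck_on_SucD_has_derivative: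
  "Ck_on (Suc k) U f \<Longrightarrow> x \<in> U \<Longrightarrow> (f has_derivative frechet_derivative f (at x)) (at x)"
  unfolding Ck_on.simps(2) by (elim conjE) (drule (1) bspec, simp only: frechet_derivative_works)

lemma Ck_on_SucD_derivative:
  "Ck_on (Suc k) U f \<Longrightarrow> Ck_on k U (\<lambda>x. frechet_derivative f (at x) v)"
  unfolding Ck_on.simps(2) by (erule conjE) (erule spec)

lemma Ck_on_Suc_imp_Ck_on:
  assumes "open U"
  shows "Ck_on (Suc k) U f \<Longrightarrow> Ck_on k U f"
proof (induction k arbitrary: f)
  case 0
  then show ?case
    by (auto simp: Ck_on.simps intro!: continuous_at_imp_continuous_on differentiable_imp_continuous_within)
next
  case (Suc k)
  note D = Ck_on_SucD_derivative[OF Suc.prems]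
  show ?case
    by (rule Ck_on_SucI[OF assms Ck_on_SucD_has_derivative[OF Suc.prems] Suc.IH[OF D]])
qed

lemma Ck_on_const: "open U \<Longrightarrow> Ck_on k U (\<lambda>x. c)"
proof (induction k arbitrary: c)
  case (Suc k)
  show ?case by (rule Ck_on_SucI[OF Suc.prems has_derivative_const Suc.IH[OF Suc.prems]])
qed (simp add: Ck_on.simps(1))

lemma Ck_on_bounded_linear:
  assumes "bounded_linear L" "open U"
  shows "Ck_on k U L"
proof (cases k)
  case 0
  then show ?thesis using assms(1) by (simp add: Ck_on.simps(1) linear_continuous_on)
next
  case (Suc k')
  show ?thesis unfolding Suc
    by (rule Ck_on_SucI[OF assms(2) bounded_linear_imp_has_derivative[OF assms(1)] Ck_on_const[OF assms(2)]])
qed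

lemma Ck_on_add:
  assumes "open U"
  shows "Ck_on k U f \<Longrightarrow> Ck_on k U g \<Longrightarrow> Ck_on k U (\<lambda>x. f x + g x)"
proof (induction k arbitrary: f g)
  case (Suc k)
  show ?case
    by (rule Ck_on_SucI[OF assms has_derivative_add[OF Suc.prems[THEN Ck_on_SucD_has_derivative]]])
      (assumption+, rule Suc.IH[OF Suc.prems[THEN Ck_on_SucD_derivative]])
qed (auto simp: Ck_on.simps(1) intro: continuous_intros)

lemma Ck_on_sum:
  assumes "open U" "\<And>i. i \<in> I \<Longrightarrow> Ck_on k U (f i)"
  shows "Ck_on k U (\<lambda>x. \<Sum>i\<in>I. f i x)"
  using assms by (induction I rule: infinite_finite_induct) (auto intro: Ck_on_const Ck_on_add)

lemma Ck_on_bilinear: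
  assumes "bounded_bilinear B" "open U"
  shows "Ck_on k U f \<Longrightarrow> Ck_on k U g \<Longrightarrow> Ck_on k U (\<lambda>x. B (f x) (g x))"
proof (induction k arbitrary: f g)
  case 0
  then show ?case using bounded_bilinear.continuous_on[OF assms(1)] by (simp add: Ck_on.simps(1))
next
  case (Suc k)
  note d = Suc.prems[THEN Ck_on_SucD_has_derivative] and lower = Suc.prems[THEN Ck_on_Suc_imp_Ck_on[OF assms(2)]]
  show ?case
    by (rule Ck_on_SucI[OF assms(2) bounded_bilinear.FDERIV[OF assms(1) d]])
      (assumption+, intro Ck_on_add[OF assms(2)] Suc.IH lower Suc.prems[THEN Ck_on_SucD_derivative])
qed

lemmas Ck_on_mult = Ck_on_bilinear[OF bounded_bilinear_mult]
  and Ck_on_scaleR = Ck_on_bilinear[OF bounded_bilinear_scaleR]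

lemma Ck_on_inner_const:
  assumes "open U" "Ck_on k U f"
  shows "Ck_on k U (\<lambda>x. f x \<bullet> b)"
  using Ck_on_bilinear[OF bounded_bilinear_inner assms] Ck_on_const[OF assms(1)] by auto

text \<open>By the chain rule the derivative of \<open>g \<circ> f\<close> along \<open>v\<close> at \<open>x\<close> is the derivative of \<open>g\<close> along the
  moving direction \<open>f' x v\<close>. The induction hypothesis applies to \<open>g\<close> differentiated along a fixed
  direction, so this vector is expanded in the basis; products and sums remain.\<close>

lemma Ck_on_compose:
  fixes f :: "'e::euclidean_space \<Rightarrow> 'f::euclidean_space"
  assumes "open U" "open V" "f ` U \<subseteq> V"
  shows "Ck_on k U f \<Longrightarrow> Ck_on k V g \<Longrightarrow> Ck_on k U (\<lambda>x. g (f x))"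
proof (induction k arbitrary: g)
  case 0
  then show ?case using continuous_on_compose2[of V g U f] assms(3) by (simp add: Ck_on.simps(1))
next
  case (Suc k)
  let ?f' = "\<lambda>x. frechet_derivative f (at x)" and ?g' = "\<lambda>y. frechet_derivative g (at y)"
  let ?D = "\<lambda>x v. \<Sum>b\<in>Basis. (?f' x v \<bullet> b) *\<^sub>R ?g' (f x) b"
  show ?case
  proof (rule Ck_on_SucI[OF assms(1)])
    fix x assume x: "x \<in> U"
    have g: "(g has_derivative ?g' (f x)) (at (f x))"
      using Ck_on_SucD_has_derivative[OF Suc.prems(2)] x assms(3) by auto
    have rep: "?g' (f x) w = (\<Sum>b\<in>Basis. (w \<bullet> b) *\<^sub>R ?g' (f x) b)" for w
    proof -
      have "?g' (f x) w = ?g' (f x) (\<Sum>b\<in>Basis. (w \<bullet> b) *\<^sub>R b)"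
        by (simp only: euclidean_representation)
      also have "\<dots> = (\<Sum>b\<in>Basis. (w \<bullet> b) *\<^sub>R ?g' (f x) b)"
        using has_derivative_linear[OF g] by (simp only: linear_sum linear_scale)
      finally show ?thesis .
    qed
    have "(\<lambda>v. ?g' (f x) (?f' x v)) = ?D x" by (rule ext) (rule rep)
    then show "((\<lambda>x. g (f x)) has_derivative ?D x) (at x)"
      using has_derivative_compose[OF Ck_on_SucD_has_derivative[OF Suc.prems(1) x] g] by (simp only:)
  next
    fix v
    have f: "Ck_on k U (\<lambda>x. ?f' x v)" by (rule Ck_on_SucD_derivative[OF Suc.prems(1)])
    have g: "Ck_on k U (\<lambda>x. ?g' (f x) b)" for b
      by (rule Suc.IH[OF Ck_on_Suc_imp_Ck_on[OF assms(1) Suc.prems(1)] Ck_on_SucD_derivative[OF Suc.prems(2)]])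
    show "Ck_on k U (\<lambda>x. ?D x v)"
      by (intro Ck_on_sum Ck_on_scaleR Ck_on_inner_const assms(1) f g)
  qed
qed

section \<open>A smooth function vanishing on a half line\<close>

text \<open>The powers of \<open>t\<close> in the denominator make the family closed under differentiation up to linear
  combinations, so that one induction shows all members smooth.\<close>

definition flat :: "nat \<Rightarrow> real \<Rightarrow> real" where
  "flat n t = (if 0 < t then exp (- (1 / t)) / t ^ n else 0)"

text \<open>Since \<open>exp (1 / t)\<close> dominates every power of \<open>1 / t\<close>, the function is quadratically small at \<open>0\<close>,
  which gives the derivative \<open>0\<close> there.\<close>

lemma flat_le: "norm (flat n t) \<le> real (n + 2) ^ (n + 2) * t\<^sup>2"
proof (cases "0 < t")
  case True
  let ?m = "n + 2"
  \<comment> \<open>the exponent \<open>n + 2\<close> absorbs the denominator \<open>t ^ n\<close> and leaves \<open>t\<^sup>2\<close>\<close>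
  have "(1 / t / real ?m) ^ ?m \<le> (1 + 1 / t / real ?m) ^ ?m"
    using True by (intro power_mono) auto
  also have "\<dots> \<le> exp (1 / t)"
    using True by (intro exp_ge_one_plus_x_over_n_power_n) (auto intro: order_trans[of _ 0])
  finally have "inverse (exp (1 / t)) \<le> inverse ((1 / t / real ?m) ^ ?m)"
    using True by (intro le_imp_inverse_le) auto
  also have "\<dots> = real ?m ^ ?m * t ^ ?m"
    using True by (simp add: power_divide power_mult_distrib divide_simps)
  finally have "exp (- (1 / t)) \<le> real ?m ^ ?m * t\<^sup>2 * t ^ n"
    by (simp add: exp_minus power_add power2_eq_square mult_ac)
  then show ?thesis using True by (simp add: flat_def divide_le_eq)
qed (simp add: flat_def)

lemma flat_has_derivative:
  "(flat n has_real_derivative flat (n + 2) t - real n * flat (n + 1) t) (at t)"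
proof (rule linorder_cases[of t 0])
  assume t: "t < 0"
  have "(flat n has_real_derivative 0) (at t)"
    by (rule has_field_derivative_transform_within_open[OF DERIV_const[of 0], where S = "{..<0}"])
      (use t in \<open>auto simp: flat_def\<close>)
  then show ?thesis using t by (simp add: flat_def)
next
  assume t: "t > 0"
  have "((\<lambda>t. exp (- (1 / t)) / t ^ n) has_real_derivative
      exp (- (1 / t)) / t ^ (n + 2) - real n * (exp (- (1 / t)) / t ^ (n + 1))) (at t)"
  proof (cases n)
    case 0
    then show ?thesis using t 
      by (auto intro!: derivative_eq_intros simp: field_simps power2_eq_square)
  next
    case (Suc m)
    show ?thesis using t unfolding Suc
      by (auto intro!: derivative_eq_intros simp: field_simps power2_eq_square) (cases m; simp)
  qed
  then have "(flat n has_real_derivative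
      exp (- (1 / t)) / t ^ (n + 2) - real n * (exp (- (1 / t)) / t ^ (n + 1))) (at t)"
    by (rule has_field_derivative_transform_within_open[where S = "{0<..}"])
      (use t in \<open>auto simp: flat_def\<close>)
  then show ?thesis using t by (simp add: flat_def)
next
  assume t: "t = 0"
  let ?C = "real (n + 2) ^ (n + 2)"
  have "((\<lambda>h. (flat n (0 + h) - flat n 0) / h) \<longlongrightarrow> 0) (at 0)"
  proof (rule Lim_null_comparison)
    show "\<forall>\<^sub>F h in at 0. norm ((flat n (0 + h) - flat n 0) / h) \<le> ?C * \<bar>h\<bar>"
    proof (rule always_eventually, rule allI)
      fix h :: real
      show "norm ((flat n (0 + h) - flat n 0) / h) \<le> ?C * \<bar>h\<bar>"
        using flat_le[of n h]
        by (cases "h = 0") (auto simp: flat_def[of n 0] divide_le_eq power2_eq_square abs_mult_self_eq mult.assoc)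
    qed
    show "((\<lambda>h. ?C * \<bar>h\<bar>) \<longlongrightarrow> 0) (at 0)"
      by (auto intro!: tendsto_eq_intros)
  qed
  then show ?thesis using t by (simp add: DERIV_def flat_def)
qed

lemma Ck_on_flat: "Ck_on k UNIV (flat n)"
proof (induction k arbitrary: n)
  case 0
  have "isCont (flat n) t" for t
    using flat_has_derivative by (rule DERIV_isCont)
  then show ?case by (simp add: Ck_on.simps(1) continuous_at_imp_continuous_on)
next
  case (Suc k)
  have D: "Ck_on k UNIV (\<lambda>x. (flat (n + 2) x + - real n * flat (n + 1) x) * v)" for v
    by (intro Ck_on_mult Ck_on_add Ck_on_const Suc.IH open_UNIV)
  show ?case
  proof (rule Ck_on_SucI[OF open_UNIV _ D])
    show "(flat n has_derivative (\<lambda>v. (flat (n + 2) t + - real n * flat (n + 1) t) * v)) (at t)" for t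
      using flat_has_derivative[of n t] by (simp add: has_field_derivative_def)
  qed
qed

section \<open>Smooth functions on Euclidean space\<close>

text \<open>The extensions that witness \<open>smooth_on\<close>.\<close>

definition Cinf_on :: "'e::euclidean_space set \<Rightarrow> ('e \<Rightarrow> 'f::real_normed_vector) \<Rightarrow> bool" where
  "Cinf_on U f \<longleftrightarrow> (\<forall>k. Ck_on k U f)"

lemma Cinf_on_subset: "Cinf_on U f \<Longrightarrow> V \<subseteq> U \<Longrightarrow> Cinf_on V f"
  unfolding Cinf_on_def by (blast intro: Ck_on_subset)

lemma Cinf_on_imp_continuous_on: "Cinf_on U f \<Longrightarrow> continuous_on U f"
  unfolding Cinf_on_def by (drule spec[of _ 0]) (simp add: Ck_on.simps(1))

lemma Cinf_on_const: "open U \<Longrightarrow> Cinf_on U (\<lambda>x. c)"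
  unfolding Cinf_on_def by (intro allI Ck_on_const)

lemma Cinf_on_bounded_linear: "bounded_linear L \<Longrightarrow> open U \<Longrightarrow> Cinf_on U L"
  unfolding Cinf_on_def by (intro allI Ck_on_bounded_linear)

lemma Cinf_on_add: "open U \<Longrightarrow> Cinf_on U f \<Longrightarrow> Cinf_on U g \<Longrightarrow> Cinf_on U (\<lambda>x. f x + g x)"
  unfolding Cinf_on_def by (intro allI Ck_on_add) (assumption | erule spec)+

lemma Cinf_on_mult:
  fixes f g :: "'e::euclidean_space \<Rightarrow> 'f::real_normed_algebra"
  shows "open U \<Longrightarrow> Cinf_on U f \<Longrightarrow> Cinf_on U g \<Longrightarrow> Cinf_on U (\<lambda>x. f x * g x)"
  unfolding Cinf_on_def by (intro allI Ck_on_mult) (assumption | erule spec)+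

lemma Cinf_on_inner:
  "open U \<Longrightarrow> Cinf_on U f \<Longrightarrow> Cinf_on U g \<Longrightarrow> Cinf_on U (\<lambda>x. f x \<bullet> g x)"
  unfolding Cinf_on_def
  by (intro allI Ck_on_bilinear[OF bounded_bilinear_inner]) (assumption | erule spec)+

lemma Cinf_on_compose:
  fixes f :: "'e::euclidean_space \<Rightarrow> 'f::euclidean_space"
  shows "open U \<Longrightarrow> open V \<Longrightarrow> f ` U \<subseteq> V \<Longrightarrow> Cinf_on U f \<Longrightarrow> Cinf_on V g \<Longrightarrow> Cinf_on U (\<lambda>x. g (f x))"
  unfolding Cinf_on_def by (rule allI, rule Ck_on_compose) (assumption | erule spec)+

lemma Cinf_on_flat: "Cinf_on UNIV (flat n)"
  unfolding Cinf_on_def by (intro allI Ck_on_flat)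

lemma smooth_on_iff:
  "smooth_on A f \<longleftrightarrow> (\<forall>x\<in>A. \<exists>U g. open U \<and> x \<in> U \<and> Cinf_on U g \<and> (\<forall>y\<in>A \<inter> U. g y = f y))"
  unfolding smooth_on_def Cinf_on_def ..

section \<open>Smooth functions on manifolds\<close>

lemma chart_left_inverse:
  assumes "smooth_manifold M" "(U, \<phi>) \<in> atlas M" "x \<in> U"
  shows "inv_into U \<phi> (\<phi> x) = x"
  using assms unfolding smooth_manifold_def is_chart_def homeomorphism_def by fastforce

lemma chart_inj:
  assumes "smooth_manifold M" "(U, \<phi>) \<in> atlas M" "x \<in> U" "y \<in> U" "\<phi> x = \<phi> y"
  shows "x = y"
  using assms chart_left_inverse by metis

lemma chart_open:
  assumes "smooth_manifold M" "(U, \<phi>) \<in> atlas M"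
  shows "open U"
  using assms unfolding smooth_manifold_def is_chart_def by fastforce

lemma chart_covers:
  assumes "smooth_manifold M"
  obtains U \<phi> where "(U, \<phi>) \<in> atlas M" "x \<in> U"
  using assms unfolding smooth_manifold_def by fastforce

lemma chart_continuous:
  assumes "smooth_manifold M" "(U, \<phi>) \<in> atlas M"
  shows "continuous_on U \<phi>" "continuous_on (\<phi> ` U) (inv_into U \<phi>)"
  using assms unfolding smooth_manifold_def is_chart_def homeomorphism_def by fastforce+

lemma chart_open_vimage:
  assumes "smooth_manifold M" "(U, \<phi>) \<in> atlas M" "open G"
  shows "open {q \<in> U. \<phi> q \<in> G}"
proof -
  have "open (\<phi> -` G \<inter> U)"
    using chart_continuous(1)[OF assms(1,2)] chart_open[OF assms(1,2)] assms(3)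
    by (simp add: continuous_on_open_vimage)
  then show ?thesis by (simp add: vimage_def Collect_conj_eq Int_commute)
qed

text \<open>The image of a chart is open in the model space only, a subspace that may be proper in the
  surrounding Euclidean space; hence the intersection with \<open>model M\<close>.\<close>

lemma chart_open_image:
  assumes "smooth_manifold M" "(U, \<phi>) \<in> atlas M" "open W"
  obtains G where "open G" "\<phi> ` (U \<inter> W) = model M \<inter> G"
proof -
  have "openin (top_of_set (\<phi> ` U)) (\<phi> ` U \<inter> inv_into U \<phi> -` W)"
    using chart_continuous(2)[OF assms(1,2)] assms(3) by (rule continuous_openin_preimage_gen)
  moreover have "\<phi> ` U \<inter> inv_into U \<phi> -` W = \<phi> ` (U \<inter> W)"
    using chart_left_inverse[OF assms(1,2)] by auto
  moreover have "openin (top_of_set (model M)) (\<phi> ` U)"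
    using assms unfolding smooth_manifold_def is_chart_def by fastforce
  ultimately show ?thesis
    using that openin_trans by (metis openin_open)
qed

text \<open>In this form, and in the introduction rule below, smoothness refers to points of the manifold
  instead of points of the chart image, so that the inverse chart disappears.\<close>

lemma smooth_fun_onD:
  assumes "smooth_manifold M" "smooth_fun_on M A f" "(U, \<phi>) \<in> atlas M" "p \<in> A" "p \<in> U"
  obtains G g where "open G" "\<phi> p \<in> G" "Cinf_on G g"
    "\<And>q. q \<in> A \<Longrightarrow> q \<in> U \<Longrightarrow> \<phi> q \<in> G \<Longrightarrow> g (\<phi> q) = f q"
proof -
  have "smooth_on (\<phi> ` (A \<inter> U)) (f \<circ> inv_into U \<phi>)"
    using assms(2,3) unfolding smooth_fun_on_def by fast
  moreover have "\<phi> p \<in> \<phi> ` (A \<inter> U)" using assms(4,5) by blast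
  ultimately obtain G g where G: "open G" "\<phi> p \<in> G" "Cinf_on G g"
    and g: "\<forall>y\<in>\<phi> ` (A \<inter> U) \<inter> G. g y = (f \<circ> inv_into U \<phi>) y"
    unfolding smooth_on_iff by blast
  show ?thesis
  proof (rule that[OF G])
    show "g (\<phi> q) = f q" if "q \<in> A" "q \<in> U" "\<phi> q \<in> G" for q
      using bspec[OF g, of "\<phi> q"] that chart_left_inverse[OF assms(1,3) that(2)] by simp
  qed
qed

lemma smooth_fun_onI:
  assumes "smooth_manifold M"
    and local: "\<And>U \<phi> p. (U, \<phi>) \<in> atlas M \<Longrightarrow> p \<in> A \<Longrightarrow> p \<in> U \<Longrightarrow>
      \<exists>G g. open G \<and> \<phi> p \<in> G \<and> Cinf_on G g \<and> (\<forall>q\<in>A \<inter> U. \<phi> q \<in> G \<longrightarrow> g (\<phi> q) = f q)"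
  shows "smooth_fun_on M A f"
  unfolding smooth_fun_on_def
proof (intro ballI, clarify)
  fix U \<phi> assume c: "(U, \<phi>) \<in> atlas M"
  show "smooth_on (\<phi> ` (A \<inter> U)) (f \<circ> inv_into U \<phi>)"
    unfolding smooth_on_iff
  proof
    fix z assume "z \<in> \<phi> ` (A \<inter> U)"
    then obtain p where p: "p \<in> A" "p \<in> U" "z = \<phi> p" by blast
    obtain G g where G: "open G" "\<phi> p \<in> G" "Cinf_on G g"
      and g: "\<forall>q\<in>A \<inter> U. \<phi> q \<in> G \<longrightarrow> g (\<phi> q) = f q"
      using local[OF c p(1,2)] by blast
    have "\<forall>y\<in>\<phi> ` (A \<inter> U) \<inter> G. g y = (f \<circ> inv_into U \<phi>) y"
      using g chart_left_inverse[OF assms(1) c] by auto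
    with G p(3) show "\<exists>G g. open G \<and> z \<in> G \<and> Cinf_on G g \<and>
        (\<forall>y\<in>\<phi> ` (A \<inter> U) \<inter> G. g y = (f \<circ> inv_into U \<phi>) y)"
      by blast
  qed
qed

lemma smooth_extensionI:
  assumes "open G" "\<phi> p \<in> G" "Cinf_on G g"
    and "\<And>q. q \<in> A \<Longrightarrow> q \<in> U \<Longrightarrow> \<phi> q \<in> G \<Longrightarrow> g (\<phi> q) = f q"
  shows "\<exists>G g. open G \<and> \<phi> p \<in> G \<and> Cinf_on G g \<and> (\<forall>q\<in>A \<inter> U. \<phi> q \<in> G \<longrightarrow> g (\<phi> q) = f q)"
  using assms by blast

lemma smooth_fun_on_subset:
  assumes "smooth_manifold M" "smooth_fun_on M A f" "B \<subseteq> A" "\<And>x. x \<in> B \<Longrightarrow> f x = g x"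
  shows "smooth_fun_on M B g"
proof (rule smooth_fun_onI[OF assms(1)])
  fix U \<phi> p assume c: "(U, \<phi>) \<in> atlas M" and p: "p \<in> B" "p \<in> U"
  obtain G h where G: "open G" "\<phi> p \<in> G" "Cinf_on G h"
    and h: "\<And>q. q \<in> A \<Longrightarrow> q \<in> U \<Longrightarrow> \<phi> q \<in> G \<Longrightarrow> h (\<phi> q) = f q"
    using smooth_fun_onD[OF assms(1,2) c subsetD[OF assms(3) p(1)] p(2)] by blast
  show "\<exists>G h. open G \<and> \<phi> p \<in> G \<and> Cinf_on G h \<and> (\<forall>q\<in>B \<inter> U. \<phi> q \<in> G \<longrightarrow> h (\<phi> q) = g q)"
    using G
    by (intro smooth_extensionI[where G = G and g = h]) (simp_all add: h subsetD[OF assms(3)] assms(4))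
qed

lemma smooth_fun_on_const: "smooth_manifold M \<Longrightarrow> smooth_fun_on M A (\<lambda>x. c)"
  by (rule smooth_fun_onI, assumption)
    (rule smooth_extensionI[where G = UNIV and g = "\<lambda>x. c"], auto intro: Cinf_on_const)

lemma smooth_fun_on_binop:
  assumes "smooth_manifold M" "smooth_fun_on M A f" "smooth_fun_on M A g"
    and op: "\<And>U f g. open U \<Longrightarrow> Cinf_on U f \<Longrightarrow> Cinf_on U g \<Longrightarrow> Cinf_on U (\<lambda>x :: 'e. b (f x) (g x))"
  shows "smooth_fun_on (M :: ('a::{t2_space, second_countable_topology}, 'e::euclidean_space) smooth_structure) A
    (\<lambda>x. b (f x) (g x))"
proof (rule smooth_fun_onI[OF assms(1)])
  fix U \<phi> p assume c: "(U, \<phi>) \<in> atlas M" and p: "p \<in> A" "p \<in> U"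
  obtain G f' where G: "open G" "\<phi> p \<in> G" "Cinf_on G f'"
    and f': "\<And>q. q \<in> A \<Longrightarrow> q \<in> U \<Longrightarrow> \<phi> q \<in> G \<Longrightarrow> f' (\<phi> q) = f q"
    using smooth_fun_onD[OF assms(1,2) c p] by blast
  obtain H g' where H: "open H" "\<phi> p \<in> H" "Cinf_on H g'"
    and g': "\<And>q. q \<in> A \<Longrightarrow> q \<in> U \<Longrightarrow> \<phi> q \<in> H \<Longrightarrow> g' (\<phi> q) = g q"
    using smooth_fun_onD[OF assms(1,3) c p] by blast
  have "Cinf_on (G \<inter> H) (\<lambda>x. b (f' x) (g' x))"
    using G(1) H(1) by (intro op open_Int Cinf_on_subset[OF G(3)] Cinf_on_subset[OF H(3)]) auto
  with G(1,2) H(1,2) show "\<exists>G h. open G \<and> \<phi> p \<in> G \<and> Cinf_on G h \<and>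
      (\<forall>q\<in>A \<inter> U. \<phi> q \<in> G \<longrightarrow> h (\<phi> q) = b (f q) (g q))"
    by (intro smooth_extensionI[where G = "G \<inter> H" and g = "\<lambda>x. b (f' x) (g' x)"])
      (auto simp: f' g')
qed

lemma smooth_fun_on_add:
  "smooth_manifold M \<Longrightarrow> smooth_fun_on M A f \<Longrightarrow> smooth_fun_on M A g \<Longrightarrow> smooth_fun_on M A (\<lambda>x. f x + g x)"
  by (rule smooth_fun_on_binop[where b = "(+)"]) (assumption | rule Cinf_on_add)+

lemma smooth_fun_on_mult:
  "smooth_manifold M \<Longrightarrow> smooth_fun_on M A f \<Longrightarrow> smooth_fun_on M A g \<Longrightarrow> smooth_fun_on M A (\<lambda>x. f x * g x)"
  by (rule smooth_fun_on_binop[where b = "(*)"]) (assumption | rule Cinf_on_mult)+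

lemma smooth_fun_on_sum:
  assumes "smooth_manifold M" "\<And>i. i \<in> I \<Longrightarrow> smooth_fun_on M A (f i)"
  shows "smooth_fun_on M A (\<lambda>x. \<Sum>i\<in>I. f i x)"
  using assms(2)
  by (induction I rule: infinite_finite_induct)
    (auto intro: smooth_fun_on_const smooth_fun_on_add assms(1))

text \<open>The subset of the chart image that corresponds to \<open>W\<close> is cut out by an open set of the Euclidean
  space, so a smooth extension for \<open>A \<inter> W\<close> restricts to one for \<open>A\<close>.\<close>

lemma smooth_fun_on_local:
  assumes M: "smooth_manifold M"
    and local: "\<And>p. p \<in> A \<Longrightarrow> \<exists>W. open W \<and> p \<in> W \<and> smooth_fun_on M (A \<inter> W) f"
  shows "smooth_fun_on M A f"
proof (rule smooth_fun_onI[OF M])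
  fix U \<phi> p assume c: "(U, \<phi>) \<in> atlas M" and p: "p \<in> A" "p \<in> U"
  obtain W where W: "open W" "p \<in> W" "smooth_fun_on M (A \<inter> W) f"
    using local[OF p(1)] by blast
  obtain G g where G: "open G" "\<phi> p \<in> G" "Cinf_on G g"
    and g: "\<And>q. q \<in> A \<inter> W \<Longrightarrow> q \<in> U \<Longrightarrow> \<phi> q \<in> G \<Longrightarrow> g (\<phi> q) = f q"
    using smooth_fun_onD[OF M W(3) c IntI[OF p(1) W(2)] p(2)] by blast
  obtain H where H: "open H" "\<phi> ` (U \<inter> W) = model M \<inter> H"
    using chart_open_image[OF M c W(1)] .
  \<comment> \<open>gives \<open>\<phi> q \<in> model M\<close> for \<open>q \<in> U\<close>\<close>
  obtain H' where H': "\<phi> ` (U \<inter> UNIV) = model M \<inter> H'"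
    using chart_open_image[OF M c open_UNIV] .
  have W_iff: "q \<in> W" if "q \<in> U" "\<phi> q \<in> H" for q
  proof -
    have "\<phi> q \<in> \<phi> ` (U \<inter> W)" using that H H' by blast
    then show ?thesis using chart_inj[OF M c that(1)] by auto
  qed
  have "\<phi> p \<in> H" using H(2) p(2) W(2) by blast
  with G(1,2) H(1) show "\<exists>G g. open G \<and> \<phi> p \<in> G \<and> Cinf_on G g \<and>
      (\<forall>q\<in>A \<inter> U. \<phi> q \<in> G \<longrightarrow> g (\<phi> q) = f q)"
    by (intro smooth_extensionI[where G = "G \<inter> H" and g = g] Cinf_on_subset[OF G(3)])
      (auto intro: g W_iff)
qed

text \<open>In any other chart the function is \<open>g\<close> composed with a transition map, whose smooth extension is
  defined on an open set of the Euclidean space.\<close>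

lemma smooth_fun_on_chart:
  assumes M: "smooth_manifold M" and c: "(V, \<psi>) \<in> atlas M" and G: "open G" "Cinf_on G g"
  shows "smooth_fun_on M {q \<in> V. \<psi> q \<in> G} (\<lambda>q. g (\<psi> q))"
proof (rule smooth_fun_onI[OF M])
  fix U \<phi> p assume c': "(U, \<phi>) \<in> atlas M" and p: "p \<in> {q \<in> V. \<psi> q \<in> G}" "p \<in> U"
  have "smooth_on (\<phi> ` (U \<inter> V)) (\<psi> \<circ> inv_into U \<phi>)"
  proof -
    have "smooth_transition (U, \<phi>) (V, \<psi>)"
      using M c c' unfolding smooth_manifold_def by blast
    then show ?thesis by (simp add: smooth_transition_def)
  qed
  moreover have "\<phi> p \<in> \<phi> ` (U \<inter> V)" using p by blast
  ultimately obtain H h where H: "open H" "\<phi> p \<in> H" "Cinf_on H h"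
    and h: "\<forall>y\<in>\<phi> ` (U \<inter> V) \<inter> H. h y = (\<psi> \<circ> inv_into U \<phi>) y"
    unfolding smooth_on_iff by blast
  have h': "h (\<phi> q) = \<psi> q" if "q \<in> U" "q \<in> V" "\<phi> q \<in> H" for q
    using bspec[OF h, of "\<phi> q"] that chart_left_inverse[OF M c' that(1)] by simp
  define H' where "H' = {y \<in> H. h y \<in> G}"
  have "open (h -` G \<inter> H)"
    using Cinf_on_imp_continuous_on[OF H(3)] H(1) G(1) by (simp add: continuous_on_open_vimage)
  moreover have "h -` G \<inter> H = H'" by (auto simp: H'_def)
  ultimately have "open H'" by simp
  moreover have "Cinf_on H' (\<lambda>y. g (h y))"
    by (rule Cinf_on_compose[OF \<open>open H'\<close> G(1) _ Cinf_on_subset[OF H(3)] G(2)]) (auto simp: H'_def)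
  moreover have "\<phi> p \<in> H'" using p h'[of p] H(2) by (simp add: H'_def)
  ultimately show "\<exists>K k. open K \<and> \<phi> p \<in> K \<and> Cinf_on K k \<and>
      (\<forall>q\<in>{q \<in> V. \<psi> q \<in> G} \<inter> U. \<phi> q \<in> K \<longrightarrow> k (\<phi> q) = g (\<psi> q))"
    by (intro smooth_extensionI[where G = H' and g = "\<lambda>y. g (h y)"]) (auto simp: H'_def h')
qed

text \<open>Smoothness on \<open>A\<close> means that extensions to open sets of the Euclidean space exist in a chart; pulled
  back along the chart they extend the function itself. For relatively open parts \<open>A\<close> of a
  submanifold this turns data along the submanifold into data on an open set.\<close>

lemma smooth_fun_on_extend:
  assumes M: "smooth_manifold M" and f: "smooth_fun_on M A f" and p: "p \<in> A"
  obtains W g where "open W" "p \<in> W" "smooth_fun_on M W g" "\<And>q. q \<in> A \<inter> W \<Longrightarrow> g q = f q"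
proof -
  obtain V \<psi> where c: "(V, \<psi>) \<in> atlas M" "p \<in> V" using chart_covers[OF M] .
  obtain G g where G: "open G" "\<psi> p \<in> G" "Cinf_on G g"
    and g: "\<And>q. q \<in> A \<Longrightarrow> q \<in> V \<Longrightarrow> \<psi> q \<in> G \<Longrightarrow> g (\<psi> q) = f q"
    using smooth_fun_onD[OF M f c(1) p c(2)] by blast
  show ?thesis
    by (rule that[OF chart_open_vimage[OF M c(1) G(1)] _ smooth_fun_on_chart[OF M c(1) G(1,3)]])
      (use c(2) G(2) g in auto)
qed

text \<open>The flat function of \<open>e\<^sup>2 - \<bar>\<psi> q - \<psi> x\<bar>\<^sup>2\<close> in a chart \<open>\<psi>\<close>, normalised at \<open>x\<close> and extended by zero.
  The extension is smooth because the chart preimage \<open>K\<close> of a small closed ball is compact, hence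
  closed in the whole manifold.\<close>

lemma bump_function:
  assumes M: "smooth_manifold M" and W: "open W" "x \<in> W"
  obtains \<beta> K where "smooth_fun M \<beta>" "\<beta> x = 1" "closed K" "K \<subseteq> W" "\<And>y. y \<notin> K \<Longrightarrow> \<beta> y = 0"
proof -
  obtain V \<psi> where c: "(V, \<psi>) \<in> atlas M" "x \<in> V" using chart_covers[OF M] .
  obtain G where G: "open G" "\<psi> ` (V \<inter> W) = model M \<inter> G"
    using chart_open_image[OF M c(1) W(1)] .
  \<comment> \<open>gives \<open>\<psi> q \<in> model M\<close> for \<open>q \<in> V\<close>\<close>
  obtain G' where G': "\<psi> ` (V \<inter> UNIV) = model M \<inter> G'"
    using chart_open_image[OF M c(1) open_UNIV] .
  have "\<psi> x \<in> G" using G(2) c(2) W(2) by blast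
  then obtain e where e: "e > 0" "cball (\<psi> x) e \<subseteq> G"
    using G(1) open_contains_cball by blast
  define K where "K = {q \<in> V. \<psi> q \<in> cball (\<psi> x) e}"
  have "K \<subseteq> W"
  proof
    fix q assume q: "q \<in> K"
    then have "\<psi> q \<in> \<psi> ` (V \<inter> W)" using e(2) G(2) G' by (auto simp: K_def)
    then show "q \<in> W" using chart_inj[OF M c(1), of q] q by (auto simp: K_def)
  qed
  have K_image: "K = inv_into V \<psi> ` (model M \<inter> cball (\<psi> x) e)" (is "K = ?K")
  proof
    show "K \<subseteq> ?K"
      using chart_left_inverse[OF M c(1)] G' by (force simp: K_def image_iff)
    show "?K \<subseteq> K"
    proof
      fix q assume "q \<in> ?K"
      then obtain z where z: "z \<in> model M" "z \<in> cball (\<psi> x) e" "q = inv_into V \<psi> z" by blast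
      then have "z \<in> \<psi> ` (V \<inter> W)" using e(2) G(2) by blast
      then obtain q' where "q' \<in> V" "z = \<psi> q'" by blast
      with z show "q \<in> K" using chart_left_inverse[OF M c(1)] by (simp add: K_def)
    qed
  qed
  have "closed (model M)"
    using M unfolding smooth_manifold_def by (simp add: closed_subspace)
  then have "compact (model M \<inter> cball (\<psi> x) e)"
    by (intro closed_Int_compact) auto
  moreover have "model M \<inter> cball (\<psi> x) e \<subseteq> \<psi> ` V"
    using e(2) G(2) by blast
  ultimately have "compact K"
    unfolding K_image using chart_continuous(2)[OF M c(1)]
    by (intro compact_continuous_image) (auto intro: continuous_on_subset)
  then have "closed K" by (rule compact_imp_closed)
  define g where "g z = flat 0 (e\<^sup>2 + - 1 * ((z - \<psi> x) \<bullet> (z - \<psi> x)))" for z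
  have "Cinf_on UNIV (\<lambda>z. z - \<psi> x)"
    using Cinf_on_add[OF open_UNIV Cinf_on_bounded_linear[OF bounded_linear_ident open_UNIV]
        Cinf_on_const[OF open_UNIV, of "- \<psi> x"]] by simp
  then have "Cinf_on UNIV (\<lambda>z. e\<^sup>2 + - 1 * ((z - \<psi> x) \<bullet> (z - \<psi> x)))"
    by (intro Cinf_on_add Cinf_on_mult Cinf_on_const Cinf_on_inner open_UNIV)
  then have Cinf_g: "Cinf_on UNIV g"
    unfolding g_def by (rule Cinf_on_compose[OF open_UNIV open_UNIV subset_UNIV _ Cinf_on_flat])
  have g_zero: "g z = 0" if "z \<notin> cball (\<psi> x) e" for z
  proof -
    have "e\<^sup>2 < (norm (z - \<psi> x))\<^sup>2"
      using that e(1) by (intro power_strict_mono) (auto simp: dist_norm norm_minus_commute)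
    then show ?thesis by (simp add: g_def flat_def power2_norm_eq_inner)
  qed
  have g_x: "g (\<psi> x) \<noteq> 0" using e(1) by (simp add: g_def flat_def)
  define \<beta> where "\<beta> q = (if q \<in> V then inverse (g (\<psi> x)) * g (\<psi> q) else 0)" for q
  have \<beta>_zero: "\<beta> q = 0" if "q \<notin> K" for q
  proof (cases "q \<in> V")
    case True
    then have "\<psi> q \<notin> cball (\<psi> x) e" using that by (simp add: K_def)
    then have "g (\<psi> q) = 0" by (rule g_zero)
    then show ?thesis by (simp add: \<beta>_def)
  qed (simp add: \<beta>_def)
  have "smooth_fun M \<beta>"
  proof (rule smooth_fun_on_local[OF M])
    fix p
    show "\<exists>W. open W \<and> p \<in> W \<and> smooth_fun_on M (UNIV \<inter> W) \<beta>"
    proof (cases "p \<in> V")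
      case True
      have "smooth_fun_on M V (\<lambda>q. inverse (g (\<psi> x)) * g (\<psi> q))"
        using smooth_fun_on_mult[OF M smooth_fun_on_const[OF M, of _ "inverse (g (\<psi> x))"] smooth_fun_on_chart[OF M c(1) open_UNIV Cinf_g]]
        by simp
      then have "smooth_fun_on M (UNIV \<inter> V) \<beta>"
        by (rule smooth_fun_on_subset[OF M]) (auto simp: \<beta>_def)
      then show ?thesis using True chart_open[OF M c(1)] by blast
    next
      case False
      have "smooth_fun_on M (UNIV \<inter> - K) \<beta>"
        using smooth_fun_on_const[OF M, of UNIV 0]
        by (rule smooth_fun_on_subset[OF M]) (auto simp: \<beta>_zero)
      moreover have "open (- K)" using \<open>closed K\<close> by auto
      moreover have "p \<in> - K" using False by (simp add: K_def)
      ultimately show ?thesis by blast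
    qed
  qed
  moreover have "\<beta> x = 1" using c(2) g_x by (simp add: \<beta>_def)
  ultimately show ?thesis using that \<open>closed K\<close> \<open>K \<subseteq> W\<close> \<beta>_zero by blast
qed

text \<open>The sets \<open>U\<close> and \<open>- K\<close> cover the manifold, and the product is smooth on the one and zero on the
  other.\<close>

lemma smooth_fun_cutoff:
  assumes M: "smooth_manifold M" and \<beta>: "smooth_fun M \<beta>" "closed K" "K \<subseteq> U" "\<And>y. y \<notin> K \<Longrightarrow> \<beta> y = 0"
    and U: "open U" "smooth_fun_on M U f"
  shows "smooth_fun M (\<lambda>y. \<beta> y * f y)"
proof (rule smooth_fun_on_local[OF M])
  fix p
  show "\<exists>W. open W \<and> p \<in> W \<and> smooth_fun_on M (UNIV \<inter> W) (\<lambda>y. \<beta> y * f y)"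
  proof (cases "p \<in> K")
    case True
    have "smooth_fun_on M (UNIV \<inter> U) (\<lambda>y. \<beta> y * f y)"
      using smooth_fun_on_mult[OF M smooth_fun_on_subset[OF M \<beta>(1)] U(2)] by simp
    then show ?thesis using True \<beta>(3) U(1) by blast
  next
    case False
    have "smooth_fun_on M (UNIV \<inter> - K) (\<lambda>y. \<beta> y * f y)"
      using smooth_fun_on_const[OF M, of UNIV 0]
      by (rule smooth_fun_on_subset[OF M]) (auto simp: \<beta>(4))
    moreover have "open (- K)" using \<beta>(2) by auto
    ultimately show ?thesis using False by blast
  qed
qed

section \<open>Sections of vector bundles\<close>

lemma basis_of_unique:
  assumes "basis_of r b V" "(\<Sum>i<r. c i *\<^sub>R b i) = (\<Sum>i<r. d i *\<^sub>R b i)" "i < r"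
  shows "c i = d i"
proof -
  have inj: "inj_on b {..<r}" and ind: "independent (b ` {..<r})"
    using assms(1) by (auto simp: basis_of_def)
  define u where "u v = c (the_inv_into {..<r} b v) - d (the_inv_into {..<r} b v)" for v
  have "(\<Sum>v\<in>b ` {..<r}. u v *\<^sub>R v) = (\<Sum>i<r. (c i - d i) *\<^sub>R b i)"
    by (simp add: sum.reindex[OF inj] u_def the_inv_into_f_f[OF inj])
  also have "\<dots> = 0"
    using assms(2) by (simp add: scaleR_left_diff_distrib sum_subtractf)
  finally have "u (b i) = 0"
    using independentD[OF ind, of "b ` {..<r}" u "b i"] assms(3) by auto
  then show ?thesis using assms(3) by (simp add: u_def the_inv_into_f_f[OF inj])
qed

lemma basis_of_span: "basis_of r b V \<Longrightarrow> v \<in> V \<Longrightarrow> \<exists>c. v = (\<Sum>i<r. c i *\<^sub>R b i)"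
proof -
  assume b: "basis_of r b V" and v: "v \<in> V"
  then have inj: "inj_on b {..<r}" and "v \<in> span (b ` {..<r})" by (auto simp: basis_of_def)
  then obtain u where "v = (\<Sum>w\<in>b ` {..<r}. u w *\<^sub>R w)"
    using span_finite[of "b ` {..<r}"] by auto
  then have "v = (\<Sum>i<r. u (b i) *\<^sub>R b i)" by (simp add: sum.reindex[OF inj])
  then show ?thesis by (rule exI[of _ "\<lambda>i. u (b i)"])
qed

lemma basis_of_subspace: "basis_of r b V \<Longrightarrow> subspace V"
  using subspace_span[of "b ` {..<r}"] by (simp add: basis_of_def)

lemma basis_of_sum_in: "basis_of r b V \<Longrightarrow> (\<Sum>i<r. c i *\<^sub>R b i) \<in> V"
  using span_base[of "b _" "b ` {..<r}"]
  by (auto simp: basis_of_def intro!: span_sum span_scale)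

locale smooth_vector_bundle =
  fixes E :: "('a::{t2_space, second_countable_topology}, 'e::euclidean_space, 'v::real_vector) metric_bundle"
  assumes manifold: "smooth_manifold (base E)" and trivializations: "vector_bundle E"
begin

abbreviation "rk \<equiv> bundle_rank E"

lemma frame_open: "(U, s) \<in> local_frames E \<Longrightarrow> open U"
  and frame_basis: "(U, s) \<in> local_frames E \<Longrightarrow> x \<in> U \<Longrightarrow> basis_of rk (\<lambda>i. s i x) (fibre E x)"
proof -
  have "\<forall>(U, s)\<in>local_frames E. open U \<and> (\<forall>x\<in>U. basis_of rk (\<lambda>i. s i x) (fibre E x))"
    using trivializations unfolding vector_bundle_def by (elim conjE)
  then show "(U, s) \<in> local_frames E \<Longrightarrow> open U"
    and "(U, s) \<in> local_frames E \<Longrightarrow> x \<in> U \<Longrightarrow> basis_of rk (\<lambda>i. s i x) (fibre E x)"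
    by auto
qed

lemma frame_covers:
  obtains U s where "(U, s) \<in> local_frames E" "x \<in> U"
proof -
  have "x \<in> (\<Union>c\<in>local_frames E. fst c)"
    using trivializations unfolding vector_bundle_def by (elim conjE) simp
  then show ?thesis using that by auto
qed

lemma frame_transition:
  assumes "(U, s) \<in> local_frames E" "(V, t) \<in> local_frames E"
  obtains g where "\<And>i j. i < rk \<Longrightarrow> j < rk \<Longrightarrow> smooth_fun_on (base E) (U \<inter> V) (g i j)"
    "\<And>j x. j < rk \<Longrightarrow> x \<in> U \<inter> V \<Longrightarrow> t j x = (\<Sum>i<rk. g i j x *\<^sub>R s i x)"
proof -
  have "\<exists>g. (\<forall>i<rk. \<forall>j<rk. smooth_fun_on (base E) (U \<inter> V) (g i j)) \<and>
            (\<forall>j<rk. \<forall>x\<in>U \<inter> V. t j x = (\<Sum>i<rk. g i j x *\<^sub>R s i x))"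
  proof -
    have "\<forall>(U, s)\<in>local_frames E. \<forall>(V, t)\<in>local_frames E.
        \<exists>g. (\<forall>i<rk. \<forall>j<rk. smooth_fun_on (base E) (U \<inter> V) (g i j)) \<and>
            (\<forall>j<rk. \<forall>x\<in>U \<inter> V. t j x = (\<Sum>i<rk. g i j x *\<^sub>R s i x))"
      using trivializations unfolding vector_bundle_def by (elim conjE)
    from bspec[OF this assms(1), unfolded split_conv, THEN bspec, OF assms(2), unfolded split_conv]
    show ?thesis .
  qed
  then show ?thesis using that by blast
qed

lemma fibre_subspace: "subspace (fibre E x)"
  using frame_covers[of x] frame_basis basis_of_subspace by metis

lemma smooth_section_onD:
  assumes "smooth_section_on E A \<sigma>" "(U, s) \<in> local_frames E"
  obtains c where "\<And>i. i < rk \<Longrightarrow> smooth_fun_on (base E) (A \<inter> U) (c i)"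
    "\<And>x. x \<in> A \<Longrightarrow> x \<in> U \<Longrightarrow> \<sigma> x = (\<Sum>i<rk. c i x *\<^sub>R s i x)"
proof -
  have "\<exists>c. (\<forall>i<rk. smooth_fun_on (base E) (A \<inter> U) (c i)) \<and>
            (\<forall>x\<in>A \<inter> U. \<sigma> x = (\<Sum>i<rk. c i x *\<^sub>R s i x))"
    using assms unfolding smooth_section_on_def by blast
  then show ?thesis using that by blast
qed

text \<open>A section is smooth once it has smooth coefficients near each point in some frame: the frame
  transitions carry them to smooth coefficients in every frame, and uniqueness of coordinates glues
  the local coefficients.\<close>

lemma smooth_section_onI_local:
  assumes local: "\<And>p. p \<in> A \<Longrightarrow> \<exists>W V t c. open W \<and> p \<in> W \<and> (V, t) \<in> local_frames E \<and> W \<subseteq> V \<and>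
      (\<forall>i<rk. smooth_fun_on (base E) (A \<inter> W) (c i)) \<and>
      (\<forall>x\<in>A \<inter> W. \<sigma> x = (\<Sum>i<rk. c i x *\<^sub>R t i x))"
  shows "smooth_section_on E A \<sigma>"
  unfolding smooth_section_on_def
proof (intro conjI ballI, goal_cases)
  case fibre: (1 p)
  then obtain W V t c where "p \<in> W" "(V, t) \<in> local_frames E" "W \<subseteq> V"
    "\<forall>x\<in>A \<inter> W. \<sigma> x = (\<Sum>i<rk. c i x *\<^sub>R t i x)"
    using local by metis
  then show ?case
    using basis_of_sum_in[OF frame_basis, of V t p] fibre by auto
next
  case (2 z)
  obtain U s where z: "z = (U, s)" by (cases z)
  then have Us: "(U, s) \<in> local_frames E" using 2 by simp
  \<comment> \<open>the coordinates of \<open>\<sigma> x\<close> in the frame \<open>s\<close>, chosen at all points at once\<close>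
  define d where "d i x = (SOME c. \<sigma> x = (\<Sum>i<rk. c i *\<^sub>R s i x)) i" for i x
  have d_unique: "d i x = c i" if "i < rk" "x \<in> U" "\<sigma> x = (\<Sum>i<rk. c i *\<^sub>R s i x)" for i x c
  proof (rule basis_of_unique[OF frame_basis[OF Us that(2)] _ that(1)])
    have "\<sigma> x = (\<Sum>i<rk. d i x *\<^sub>R s i x)"
      unfolding d_def by (rule someI[of _ c]) (rule that(3))
    then show "(\<Sum>i<rk. d i x *\<^sub>R s i x) = (\<Sum>i<rk. c i *\<^sub>R s i x)" using that(3) by simp
  qed
  have loc: "\<exists>W. open W \<and> p \<in> W \<and> (\<forall>i<rk. smooth_fun_on (base E) (A \<inter> U \<inter> W) (d i)) \<and>
      \<sigma> p = (\<Sum>i<rk. d i p *\<^sub>R s i p)" if p: "p \<in> A" "p \<in> U" for p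
  proof -
    obtain W V t c where W: "open W" "p \<in> W" "(V, t) \<in> local_frames E" "W \<subseteq> V"
      and c: "\<forall>i<rk. smooth_fun_on (base E) (A \<inter> W) (c i)"
        "\<forall>x\<in>A \<inter> W. \<sigma> x = (\<Sum>i<rk. c i x *\<^sub>R t i x)"
      using local[OF p(1)] by blast
    obtain g where g: "\<And>i j. i < rk \<Longrightarrow> j < rk \<Longrightarrow> smooth_fun_on (base E) (U \<inter> V) (g i j)"
      "\<And>j x. j < rk \<Longrightarrow> x \<in> U \<inter> V \<Longrightarrow> t j x = (\<Sum>i<rk. g i j x *\<^sub>R s i x)"
      using frame_transition[OF Us W(3)] by blast
    define b where "b i x = (\<Sum>j<rk. c j x * g i j x)" for i x
    have \<sigma>: "\<sigma> x = (\<Sum>i<rk. b i x *\<^sub>R s i x)" if "x \<in> A \<inter> U \<inter> W" for x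
    proof -
      have "\<sigma> x = (\<Sum>j<rk. c j x *\<^sub>R (\<Sum>i<rk. g i j x *\<^sub>R s i x))"
        using that c(2) W(4) by (auto intro!: sum.cong simp: g(2))
      also have "\<dots> = (\<Sum>i<rk. \<Sum>j<rk. c j x *\<^sub>R g i j x *\<^sub>R s i x)"
        unfolding scaleR_sum_right by (rule sum.swap)
      also have "\<dots> = (\<Sum>i<rk. b i x *\<^sub>R s i x)"
        by (simp add: b_def scaleR_sum_left)
      finally show ?thesis .
    qed
    have "smooth_fun_on (base E) (A \<inter> U \<inter> W) (d i)" if i: "i < rk" for i
    proof (rule smooth_fun_on_subset[OF manifold])
      show "smooth_fun_on (base E) (A \<inter> U \<inter> W) (b i)"
        unfolding b_def
      proof (intro smooth_fun_on_sum smooth_fun_on_mult manifold)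
        fix j assume j: "j \<in> {..<rk}"
        show "smooth_fun_on (base E) (A \<inter> U \<inter> W) (c j)"
          by (rule smooth_fun_on_subset[OF manifold, of "A \<inter> W" "c j"]) (use c(1) j in auto)
        show "smooth_fun_on (base E) (A \<inter> U \<inter> W) (g i j)"
          by (rule smooth_fun_on_subset[OF manifold g(1)]) (use i j W(4) in auto)
      qed
      show "b i x = d i x" if "x \<in> A \<inter> U \<inter> W" for x
        using d_unique[OF i _ \<sigma>[OF that]] that by simp
    qed simp
    moreover have "\<sigma> p = (\<Sum>i<rk. d i p *\<^sub>R s i p)"
    proof -
      have pW: "p \<in> A \<inter> U \<inter> W" using p W(2) by simp
      have "(\<Sum>i<rk. b i p *\<^sub>R s i p) = (\<Sum>i<rk. d i p *\<^sub>R s i p)"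
        using d_unique[OF _ p(2) \<sigma>[OF pW]] by (intro sum.cong) auto
      then show ?thesis using \<sigma>[OF pW] by simp
    qed
    ultimately show ?thesis using W by blast
  qed
  have "\<forall>i<rk. smooth_fun_on (base E) (A \<inter> U) (d i)"
    using loc by (intro allI impI smooth_fun_on_local[OF manifold]) blast
  moreover have "\<forall>x\<in>A \<inter> U. \<sigma> x = (\<Sum>i<rk. d i x *\<^sub>R s i x)"
    using loc by blast
  ultimately show ?case unfolding z by blast
qed

lemma smooth_section_on_frame:
  assumes "(U, s) \<in> local_frames E" "\<And>i. i < rk \<Longrightarrow> smooth_fun_on (base E) (A \<inter> U) (c i)"
  shows "smooth_section_on E (A \<inter> U) (\<lambda>x. \<Sum>i<rk. c i x *\<^sub>R s i x)"
proof (rule smooth_section_onI_local, intro exI conjI)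
  show "open U" "(U, s) \<in> local_frames E" using assms(1) frame_open by auto
  show "\<forall>i<rk. smooth_fun_on (base E) (A \<inter> U \<inter> U) (c i)" using assms(2) by simp
qed auto

lemma smooth_section_on_lincomb:
  assumes "smooth_section_on E A \<psi>" "smooth_section_on E A \<phi>"
    "smooth_fun_on (base E) A f" "smooth_fun_on (base E) A g"
  shows "smooth_section_on E A (\<lambda>x. f x *\<^sub>R \<psi> x + g x *\<^sub>R \<phi> x)"
proof (rule smooth_section_onI_local)
  fix p assume "p \<in> A"
  obtain U s where U: "(U, s) \<in> local_frames E" "p \<in> U" by (rule frame_covers)
  obtain c where c: "\<And>i. i < rk \<Longrightarrow> smooth_fun_on (base E) (A \<inter> U) (c i)"
    "\<And>x. x \<in> A \<Longrightarrow> x \<in> U \<Longrightarrow> \<psi> x = (\<Sum>i<rk. c i x *\<^sub>R s i x)"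
    using smooth_section_onD[OF assms(1) U(1)] by blast
  obtain d where d: "\<And>i. i < rk \<Longrightarrow> smooth_fun_on (base E) (A \<inter> U) (d i)"
    "\<And>x. x \<in> A \<Longrightarrow> x \<in> U \<Longrightarrow> \<phi> x = (\<Sum>i<rk. d i x *\<^sub>R s i x)"
    using smooth_section_onD[OF assms(2) U(1)] by blast
  have fg: "smooth_fun_on (base E) (A \<inter> U) f" "smooth_fun_on (base E) (A \<inter> U) g"
    by (rule smooth_fun_on_subset[OF manifold assms(3)], simp, simp)
      (rule smooth_fun_on_subset[OF manifold assms(4)], simp, simp)
  let ?c = "\<lambda>i x. f x * c i x + g x * d i x"
  have "smooth_fun_on (base E) (A \<inter> U) (?c i)" if "i < rk" for i
    by (intro smooth_fun_on_add smooth_fun_on_mult manifold fg c(1) d(1) that)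
  moreover have "f x *\<^sub>R \<psi> x + g x *\<^sub>R \<phi> x = (\<Sum>i<rk. ?c i x *\<^sub>R s i x)" if "x \<in> A \<inter> U" for x
    using that by (simp add: c(2) d(2) scaleR_sum_right scaleR_left_distrib sum.distrib)
  moreover note U frame_open[OF U(1)]
  ultimately show "\<exists>W V t c. open W \<and> p \<in> W \<and> (V, t) \<in> local_frames E \<and> W \<subseteq> V \<and>
      (\<forall>i<rk. smooth_fun_on (base E) (A \<inter> W) (c i)) \<and>
      (\<forall>x\<in>A \<inter> W. f x *\<^sub>R \<psi> x + g x *\<^sub>R \<phi> x = (\<Sum>i<rk. c i x *\<^sub>R t i x))"
    by (intro exI[of _ U] exI[of _ s] exI[of _ ?c]) blast
qed

lemma smooth_section_on_zero: "smooth_section_on E A (\<lambda>x. 0)"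
proof (rule smooth_section_onI_local)
  fix p assume "p \<in> A"
  obtain U s where U: "(U, s) \<in> local_frames E" "p \<in> U" by (rule frame_covers)
  then show "\<exists>W V t c. open W \<and> p \<in> W \<and> (V, t) \<in> local_frames E \<and> W \<subseteq> V \<and>
      (\<forall>i<rk. smooth_fun_on (base E) (A \<inter> W) (c i)) \<and>
      (\<forall>x\<in>A \<inter> W. 0 = (\<Sum>i<rk. c i x *\<^sub>R t i x))"
    using frame_open[OF U(1)]
    by (intro exI[of _ U] exI[of _ s] exI[of _ "\<lambda>i x. 0"]) (auto intro: smooth_fun_on_const manifold)
qed

lemma sections_lincomb:
  "\<psi> \<in> sections E \<Longrightarrow> \<phi> \<in> sections E \<Longrightarrow> smooth_fun (base E) f \<Longrightarrow> smooth_fun (base E) g \<Longrightarrow>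
    (\<lambda>x. f x *\<^sub>R \<psi> x + g x *\<^sub>R \<phi> x) \<in> sections E"
  unfolding sections_def by (simp add: smooth_section_on_lincomb)

lemma sections_zero: "(\<lambda>x. 0) \<in> sections E"
  unfolding sections_def by (simp add: smooth_section_on_zero)

lemma sections_add: "\<psi> \<in> sections E \<Longrightarrow> \<phi> \<in> sections E \<Longrightarrow> (\<lambda>x. \<psi> x + \<phi> x) \<in> sections E"
  using sections_lincomb[of \<psi> \<phi> "\<lambda>x. 1" "\<lambda>x. 1"] smooth_fun_on_const[OF manifold] by simp

lemma sections_scale: "\<psi> \<in> sections E \<Longrightarrow> smooth_fun (base E) f \<Longrightarrow> (\<lambda>x. f x *\<^sub>R \<psi> x) \<in> sections E"
  using sections_lincomb[of \<psi> \<psi> f "\<lambda>x. 0"] smooth_fun_on_const[OF manifold] by simp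

lemma sections_sum:
  "(\<And>i. i \<in> I \<Longrightarrow> t i \<in> sections E) \<Longrightarrow> (\<lambda>x. \<Sum>i\<in>I. t i x) \<in> sections E"
  by (induction I rule: infinite_finite_induct) (auto intro: sections_zero sections_add)

lemma sections_fibre: "\<psi> \<in> sections E \<Longrightarrow> \<psi> x \<in> fibre E x"
  unfolding sections_def smooth_section_on_def by blast

lemma section_cutoff:
  assumes \<beta>: "smooth_fun (base E) \<beta>" "closed K" "K \<subseteq> U" "\<And>y. y \<notin> K \<Longrightarrow> \<beta> y = 0"
    and U: "open U" "smooth_section_on E U \<sigma>"
  shows "(\<lambda>y. \<beta> y *\<^sub>R \<sigma> y) \<in> sections E"
proof -
  have "smooth_section_on E UNIV (\<lambda>y. \<beta> y *\<^sub>R \<sigma> y)"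
  proof (rule smooth_section_onI_local)
    fix p
    obtain V t where V: "(V, t) \<in> local_frames E" "p \<in> V" by (rule frame_covers)
    show "\<exists>W V t c. open W \<and> p \<in> W \<and> (V, t) \<in> local_frames E \<and> W \<subseteq> V \<and>
      (\<forall>i<rk. smooth_fun_on (base E) (UNIV \<inter> W) (c i)) \<and>
      (\<forall>x\<in>UNIV \<inter> W. \<beta> x *\<^sub>R \<sigma> x = (\<Sum>i<rk. c i x *\<^sub>R t i x))"
    proof (cases "p \<in> U")
      case True
      obtain c where c: "\<And>i. i < rk \<Longrightarrow> smooth_fun_on (base E) (U \<inter> V) (c i)"
        "\<And>x. x \<in> U \<Longrightarrow> x \<in> V \<Longrightarrow> \<sigma> x = (\<Sum>i<rk. c i x *\<^sub>R t i x)"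
        using smooth_section_onD[OF U(2) V(1)] by blast
      let ?c = "\<lambda>i x. \<beta> x * c i x"
      have "smooth_fun_on (base E) (U \<inter> V) (?c i)" if "i < rk" for i
        using smooth_fun_on_subset[OF manifold \<beta>(1) subset_UNIV refl]
        by (rule smooth_fun_on_mult[OF manifold _ c(1)[OF that]])
      moreover have "\<beta> x *\<^sub>R \<sigma> x = (\<Sum>i<rk. ?c i x *\<^sub>R t i x)" if "x \<in> U \<inter> V" for x
        using that by (simp add: c(2) scaleR_sum_right)
      moreover have "open (U \<inter> V)" using U(1) frame_open[OF V(1)] by blast
      ultimately show ?thesis using True V
        by (intro exI[of _ "U \<inter> V"] exI[of _ V] exI[of _ t] exI[of _ ?c]) simp
    next
      case False
      have "open (V - K)" using frame_open[OF V(1)] \<beta>(2) by blast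
      then show ?thesis using False V \<beta>(3,4)
        by (intro exI[of _ "V - K"] exI[of _ V] exI[of _ t] exI[of _ "\<lambda>i x. 0"])
          (auto intro: smooth_fun_on_const manifold)
    qed
  qed
  then show ?thesis by (simp add: sections_def)
qed

text \<open>The coefficients of \<open>\<sigma>\<close> in a frame extend from \<open>A\<close> to a neighbourhood of \<open>x\<close>, and a bump function
  cuts the extended section off. The result is a multiple of \<open>\<sigma>\<close> wherever it is nonzero on \<open>A\<close>, so
  it stays inside any family of subspaces over \<open>A\<close> that contains \<open>\<sigma>\<close> over \<open>A \<inter> U\<close>, even if \<open>A\<close>
  is not closed.\<close>

lemma section_extension:
  assumes U: "open U" "x \<in> A" "x \<in> U" and \<sigma>: "smooth_section_on E (A \<inter> U) \<sigma>"
  obtains \<psi> where "\<psi> \<in> sections E" "\<psi> x = \<sigma> x"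
    "\<And>y. y \<in> A \<Longrightarrow> \<psi> y = 0 \<or> y \<in> U \<and> (\<exists>c. \<psi> y = c *\<^sub>R \<sigma> y)"
proof -
  obtain V s where V: "(V, s) \<in> local_frames E" "x \<in> V" by (rule frame_covers)
  obtain c where c: "\<And>i. i < rk \<Longrightarrow> smooth_fun_on (base E) (A \<inter> U \<inter> V) (c i)"
    "\<And>y. y \<in> A \<inter> U \<Longrightarrow> y \<in> V \<Longrightarrow> \<sigma> y = (\<Sum>i<rk. c i y *\<^sub>R s i y)"
    using smooth_section_onD[OF \<sigma> V(1)] by blast
  have "\<exists>W g. open W \<and> x \<in> W \<and> smooth_fun_on (base E) W g \<and> (\<forall>q\<in>A \<inter> U \<inter> V \<inter> W. g q = c i q)"
    if "i < rk" for i
  proof -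
    have "x \<in> A \<inter> U \<inter> V" using U(2,3) V(2) by simp
    then show ?thesis
      by (rule smooth_fun_on_extend[OF manifold c(1)[OF that]]) (intro exI conjI ballI; assumption)
  qed
  then have "\<forall>i. \<exists>W g. i < rk \<longrightarrow> open W \<and> x \<in> W \<and> smooth_fun_on (base E) W g \<and>
      (\<forall>q\<in>A \<inter> U \<inter> V \<inter> W. g q = c i q)"
    by blast
  then obtain W g where W: "\<And>i. i < rk \<Longrightarrow> open (W i) \<and> x \<in> W i"
    and g: "\<And>i. i < rk \<Longrightarrow> smooth_fun_on (base E) (W i) (g i)"
    and gc: "\<And>i q. i < rk \<Longrightarrow> q \<in> A \<inter> U \<inter> V \<inter> W i \<Longrightarrow> g i q = c i q"
    by metis
  define Z where "Z = (U \<inter> (\<Inter>i<rk. W i)) \<inter> V"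
  have "open Z" unfolding Z_def
    using U(1) W frame_open[OF V(1)] by (intro open_Int open_INT) auto
  moreover have "x \<in> Z" using U(3) V(2) W by (simp add: Z_def)
  ultimately obtain \<beta> K where \<beta>: "smooth_fun (base E) \<beta>" "\<beta> x = 1" "closed K" "K \<subseteq> Z"
    "\<And>y. y \<notin> K \<Longrightarrow> \<beta> y = 0"
    using bump_function[OF manifold] by blast
  let ?\<tau> = "\<lambda>y. \<Sum>i<rk. g i y *\<^sub>R s i y"
  have "smooth_section_on E Z ?\<tau>"
    unfolding Z_def
  proof (rule smooth_section_on_frame[OF V(1)])
    show "smooth_fun_on (base E) (U \<inter> (\<Inter>i<rk. W i) \<inter> V) (g i)" if "i < rk" for i
      by (rule smooth_fun_on_subset[OF manifold g[OF that]]) (use that in auto)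
  qed
  then have sec: "(\<lambda>y. \<beta> y *\<^sub>R ?\<tau> y) \<in> sections E"
    using section_cutoff[OF \<beta>(1,3,4) _ \<open>open Z\<close>, of ?\<tau>] \<beta>(5) by blast
  have \<tau>: "?\<tau> y = \<sigma> y" if "y \<in> A" "y \<in> Z" for y
    using that c(2)[of y] by (auto simp: Z_def gc)
  show ?thesis
  proof (rule that[OF sec])
    show "\<beta> x *\<^sub>R ?\<tau> x = \<sigma> x" using \<tau>[OF U(2) \<open>x \<in> Z\<close>] \<beta>(2) by simp
    fix y assume "y \<in> A"
    then show "\<beta> y *\<^sub>R ?\<tau> y = 0 \<or> y \<in> U \<and> (\<exists>c. \<beta> y *\<^sub>R ?\<tau> y = c *\<^sub>R \<sigma> y)"
    proof (cases "y \<in> Z")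
      case True
      then show ?thesis using \<tau>[OF \<open>y \<in> A\<close>] unfolding Z_def by auto
    next
      case False
      then have "\<beta> y = 0" using \<beta>(4,5) by blast
      then show ?thesis by simp
    qed
  qed
qed

lemma section_through:
  assumes "u \<in> fibre E x"
  obtains \<psi> where "\<psi> \<in> sections E" "\<psi> x = u"
proof -
  obtain V s where V: "(V, s) \<in> local_frames E" "x \<in> V" by (rule frame_covers)
  obtain c where c: "u = (\<Sum>i<rk. c i *\<^sub>R s i x)"
    using basis_of_span[OF frame_basis[OF V] assms] by blast
  have "smooth_section_on E (UNIV \<inter> V) (\<lambda>y. \<Sum>i<rk. c i *\<^sub>R s i y)"
    by (rule smooth_section_on_frame[OF V(1) smooth_fun_on_const[OF manifold]])
  from section_extension[OF frame_open[OF V(1)] UNIV_I V(2) this] c that show ?thesis by metis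
qed

lemma section_in_subbundle:
  assumes L: "subbundle E S L" and x: "x \<in> S" and v: "v \<in> L x"
  obtains \<psi> where "\<psi> \<in> sections_in E S L" "\<psi> x = v"
proof -
  from L x obtain r U s where U: "open U" "x \<in> U"
    and s: "\<forall>i<r. smooth_section_on E (S \<inter> U) (s i)" "\<forall>y\<in>S \<inter> U. basis_of r (\<lambda>i. s i y) (L y)"
    unfolding subbundle_def by blast
  have L_subspace: "subspace (L y)" if "y \<in> S" for y
    using L that basis_of_subspace unfolding subbundle_def by blast
  obtain c where c: "v = (\<Sum>i<r. c i *\<^sub>R s i x)"
    using basis_of_span[OF _ v] s(2) x U(2) by blast
  have "smooth_section_on E (S \<inter> U) (\<lambda>y. \<Sum>i\<in>I. c i *\<^sub>R s i y)" if "I \<subseteq> {..<r}" for I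
    using finite_subset[OF that finite_lessThan] that
  proof (induction I rule: finite_induct)
    case (insert i I)
    then have "smooth_section_on E (S \<inter> U) (\<lambda>y. c i *\<^sub>R s i y + 1 *\<^sub>R (\<Sum>i\<in>I. c i *\<^sub>R s i y))"
      using s(1) by (intro smooth_section_on_lincomb smooth_fun_on_const manifold) auto
    with insert show ?case by simp
  qed (simp add: smooth_section_on_zero)
  from this[OF subset_refl] obtain \<psi> where \<psi>: "\<psi> \<in> sections E" "\<psi> x = (\<Sum>i<r. c i *\<^sub>R s i x)"
    "\<And>y. y \<in> S \<Longrightarrow> \<psi> y = 0 \<or> y \<in> U \<and> (\<exists>a. \<psi> y = a *\<^sub>R (\<Sum>i<r. c i *\<^sub>R s i y))"
    by (rule section_extension[OF U(1) x U(2)]) blast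
  have "\<psi> y \<in> L y" if y: "y \<in> S" for y
  proof (cases "\<psi> y = 0")
    case True
    then show ?thesis using subspace_0[OF L_subspace[OF y]] by simp
  next
    case False
    with \<psi>(3)[OF y] obtain a where U: "y \<in> U" and a: "\<psi> y = a *\<^sub>R (\<Sum>i<r. c i *\<^sub>R s i y)" by blast
    have "basis_of r (\<lambda>i. s i y) (L y)" using s(2) y U by blast
    from basis_of_sum_in[OF this] show ?thesis
      unfolding a by (rule subspace_scale[OF L_subspace[OF y]])
  qed
  then show ?thesis using that[of \<psi>] \<psi>(1,2) c by (simp add: sections_in_def)
qed

end

section \<open>Maps linear over smooth functions\<close>

context smooth_vector_bundle
begin

text \<open>If \<open>\<delta> = \<Sum>\<^sub>i c\<^sub>i s\<^sub>i\<close> in a frame around \<open>x\<close> and \<open>\<delta> x = 0\<close>, then with a bump function \<open>\<beta>\<close> at \<open>x\<close> the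
  identity \<open>\<beta>\<^sup>2 \<delta> = \<Sum>\<^sub>i (\<beta> c\<^sub>i) (\<beta> s\<^sub>i)\<close> holds globally, with global functions and sections. Linearity
  gives \<open>F \<delta> = \<Sum>\<^sub>i \<beta>(x) c\<^sub>i(x) F (\<beta> s\<^sub>i) = 0\<close>.\<close>

lemma pointwise_if_Cinf_linear:
  fixes F :: "('a \<Rightarrow> 'v) \<Rightarrow> real"
  assumes add: "\<And>\<psi> \<phi>. \<psi> \<in> sections E \<Longrightarrow> \<phi> \<in> sections E \<Longrightarrow> F (\<lambda>y. \<psi> y + \<phi> y) = F \<psi> + F \<phi>"
    and scale: "\<And>f \<psi>. smooth_fun (base E) f \<Longrightarrow> \<psi> \<in> sections E \<Longrightarrow> F (\<lambda>y. f y *\<^sub>R \<psi> y) = f x * F \<psi>"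
    and \<psi>: "\<psi> \<in> sections E" and \<phi>: "\<phi> \<in> sections E" and eq: "\<psi> x = \<phi> x"
  shows "F \<psi> = F \<phi>"
proof -
  have zero: "F \<delta> = 0" if \<delta>: "\<delta> \<in> sections E" "\<delta> x = 0" for \<delta>
  proof -
    obtain U s where U: "(U, s) \<in> local_frames E" "x \<in> U" by (rule frame_covers)
    have "smooth_section_on E UNIV \<delta>" using \<delta>(1) by (simp add: sections_def)
    then obtain c where c: "\<And>i. i < rk \<Longrightarrow> smooth_fun_on (base E) (UNIV \<inter> U) (c i)"
      "\<And>y. y \<in> UNIV \<Longrightarrow> y \<in> U \<Longrightarrow> \<delta> y = (\<Sum>i<rk. c i y *\<^sub>R s i y)"
      using smooth_section_onD[OF _ U(1)] by blast
    have c_zero: "c i x = 0" if "i < rk" for i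
      using basis_of_unique[OF frame_basis[OF U], of "\<lambda>i. c i x" "\<lambda>i. 0"] c(2)[OF UNIV_I U(2)] \<delta>(2) that
      by simp
    obtain \<beta> K where \<beta>: "smooth_fun (base E) \<beta>" "\<beta> x = 1" "closed K" "K \<subseteq> U"
      and \<beta>_zero: "\<And>y. y \<notin> K \<Longrightarrow> \<beta> y = 0"
      using bump_function[OF manifold frame_open[OF U(1)] U(2)] by blast
    have a: "smooth_fun (base E) (\<lambda>y. \<beta> y * c i y)" if "i < rk" for i
      using smooth_fun_cutoff[OF manifold \<beta>(1,3,4) \<beta>_zero frame_open[OF U(1)]] c(1)[OF that] by simp
    have s: "smooth_section_on E U (s i)" if i: "i < rk" for i
    proof -
      have "smooth_section_on E (UNIV \<inter> U) (\<lambda>y. \<Sum>j<rk. (if j = i then 1 else 0) *\<^sub>R s j y)"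
        by (rule smooth_section_on_frame[OF U(1) smooth_fun_on_const[OF manifold]])
      then show ?thesis using i by (simp add: if_distrib[of "\<lambda>a. a *\<^sub>R _"] sum.delta cong: if_cong)
    qed
    have t: "(\<lambda>y. \<beta> y *\<^sub>R s i y) \<in> sections E" if "i < rk" for i
      using section_cutoff[OF \<beta>(1,3,4) _ frame_open[OF U(1)] s[OF that]] \<beta>_zero by blast
    have F_sum: "F (\<lambda>y. \<Sum>i\<in>I. (\<beta> y * c i y) *\<^sub>R (\<beta> y *\<^sub>R s i y)) = 0" if "I \<subseteq> {..<rk}" for I
      using finite_subset[OF that finite_lessThan] that
    proof (induction I rule: finite_induct)
      case empty
      have "F (\<lambda>y. 0 *\<^sub>R \<delta> y) = 0"
        using scale[OF smooth_fun_on_const[OF manifold, of _ 0] \<delta>(1)] by simp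
      then show ?case by simp
    next
      case (insert i I)
      let ?t = "\<lambda>i y. (\<beta> y * c i y) *\<^sub>R (\<beta> y *\<^sub>R s i y)"
      have sec: "?t j \<in> sections E" if "j < rk" for j
        by (rule sections_scale[OF t[OF that] a[OF that]])
      have i: "i < rk" and I: "\<And>j. j \<in> I \<Longrightarrow> j < rk" using insert.prems by auto
      have "F (\<lambda>y. \<Sum>j\<in>insert i I. ?t j y) = F (\<lambda>y. ?t i y + (\<Sum>j\<in>I. ?t j y))"
        using insert.hyps by simp
      also have "\<dots> = F (?t i) + F (\<lambda>y. \<Sum>j\<in>I. ?t j y)"
        by (rule add[OF sec[OF i] sections_sum[OF sec[OF I]]])
      also have "F (?t i) = 0"
        using scale[OF a[OF i] t[OF i]] c_zero[OF i] by simp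
      also have "F (\<lambda>y. \<Sum>j\<in>I. ?t j y) = 0"
        using insert.IH insert.prems by simp
      finally show ?case by simp
    qed
    have "(\<lambda>y. \<beta> y *\<^sub>R (\<beta> y *\<^sub>R \<delta> y)) = (\<lambda>y. \<Sum>i<rk. (\<beta> y * c i y) *\<^sub>R (\<beta> y *\<^sub>R s i y))"
    proof
      fix y
      show "\<beta> y *\<^sub>R (\<beta> y *\<^sub>R \<delta> y) = (\<Sum>i<rk. (\<beta> y * c i y) *\<^sub>R (\<beta> y *\<^sub>R s i y))"
      proof (cases "y \<in> U")
        case True
        show ?thesis using c(2)[OF UNIV_I True]
          by (simp add: scaleR_sum_right mult_ac)
      next
        case False
        then have "\<beta> y = 0" using \<beta>(4) \<beta>_zero by blast
        then show ?thesis by simp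
      qed
    qed
    then have "F (\<lambda>y. \<beta> y *\<^sub>R (\<beta> y *\<^sub>R \<delta> y)) = 0"
      using F_sum[OF subset_refl] by simp
    then show ?thesis
      using scale[OF \<beta>(1) sections_scale[OF \<delta>(1) \<beta>(1)]] scale[OF \<beta>(1) \<delta>(1)] \<beta>(2) by simp
  qed
  let ?\<delta> = "\<lambda>y. \<psi> y + (-1) *\<^sub>R \<phi> y"
  have m: "(\<lambda>y. (-1) *\<^sub>R \<phi> y) \<in> sections E"
    by (rule sections_scale[OF \<phi> smooth_fun_on_const[OF manifold]])
  have "F ?\<delta> = F \<psi> + F (\<lambda>y. (-1) *\<^sub>R \<phi> y)" by (rule add[OF \<psi> m])
  also have "F (\<lambda>y. (-1) *\<^sub>R \<phi> y) = - F \<phi>"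
    using scale[OF smooth_fun_on_const[OF manifold, of _ "- 1"] \<phi>] by simp
  finally show ?thesis using zero[OF sections_add[OF \<psi> m]] eq by simp
qed

end

section \<open>Torsion of a Courant algebroid connection\<close>

locale courant_algebroid_connection =
  fixes E :: "('a::{t2_space, second_countable_topology}, 'e::euclidean_space, 'v::real_vector) metric_bundle"
    and br nab :: "('a \<Rightarrow> 'v) \<Rightarrow> ('a \<Rightarrow> 'v) \<Rightarrow> 'a \<Rightarrow> 'v"
  assumes algebroid: "courant_algebroid E br" and connection: "courant_connection E nab"
begin

sublocale smooth_vector_bundle E
  using algebroid by unfold_locales (simp_all add: courant_algebroid_def)

lemma anchor_axioms: "is_anchor E" and metric_axioms: "is_metric E"
  using algebroid by (simp_all add: courant_algebroid_def)

lemma metric_lincomb_left: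
  "u \<in> fibre E x \<Longrightarrow> v \<in> fibre E x \<Longrightarrow> w \<in> fibre E x \<Longrightarrow>
    metric E x (a *\<^sub>R u + b *\<^sub>R v) w = a * metric E x u w + b * metric E x v w"
  using metric_axioms unfolding is_metric_def by (elim conjE) simp

lemma metric_sym: "u \<in> fibre E x \<Longrightarrow> v \<in> fibre E x \<Longrightarrow> metric E x u v = metric E x v u"
  using metric_axioms unfolding is_metric_def by (elim conjE) blast

lemma metric_smooth:
  "\<psi> \<in> sections E \<Longrightarrow> \<phi> \<in> sections E \<Longrightarrow> smooth_fun (base E) (\<lambda>x. metric E x (\<psi> x) (\<phi> x))"
proof -
  have "\<forall>\<psi>\<in>sections E. \<forall>\<phi>\<in>sections E. smooth_fun (base E) (\<lambda>x. metric E x (\<psi> x) (\<phi> x))"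
    using metric_axioms unfolding is_metric_def by (elim conjE)
  then show "\<psi> \<in> sections E \<Longrightarrow> \<phi> \<in> sections E \<Longrightarrow> smooth_fun (base E) (\<lambda>x. metric E x (\<psi> x) (\<phi> x))"
    by simp
qed

lemma metric_lincomb_right:
  assumes "u \<in> fibre E x" "v \<in> fibre E x" "w \<in> fibre E x"
  shows "metric E x w (a *\<^sub>R u + b *\<^sub>R v) = a * metric E x w u + b * metric E x w v"
proof -
  have "a *\<^sub>R u + b *\<^sub>R v \<in> fibre E x"
    using assms fibre_subspace by (simp add: subspace_add subspace_scale)
  then show ?thesis
    using metric_lincomb_left[OF assms, of a b] metric_sym[OF assms(3)] assms by simp
qed

lemma metric_add_left:
  "u \<in> fibre E x \<Longrightarrow> v \<in> fibre E x \<Longrightarrow> w \<in> fibre E x \<Longrightarrow> metric E x (u + v) w = metric E x u w + metric E x v w"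
  using metric_lincomb_left[of u x v w 1 1] by simp

lemma metric_diff_left:
  "u \<in> fibre E x \<Longrightarrow> v \<in> fibre E x \<Longrightarrow> w \<in> fibre E x \<Longrightarrow> metric E x (u - v) w = metric E x u w - metric E x v w"
  using metric_lincomb_left[of u x v w 1 "- 1"] by simp

lemma metric_scale_left:
  "u \<in> fibre E x \<Longrightarrow> w \<in> fibre E x \<Longrightarrow> metric E x (a *\<^sub>R u) w = a * metric E x u w"
  using metric_lincomb_left[of u x u w a 0] by simp

lemma metric_add_right:
  "u \<in> fibre E x \<Longrightarrow> v \<in> fibre E x \<Longrightarrow> w \<in> fibre E x \<Longrightarrow> metric E x w (u + v) = metric E x w u + metric E x w v"
  using metric_lincomb_right[of u x v w 1 1] by simp

lemma metric_scale_right: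
  "u \<in> fibre E x \<Longrightarrow> w \<in> fibre E x \<Longrightarrow> metric E x w (a *\<^sub>R u) = a * metric E x w u"
  using metric_lincomb_right[of u x u w a 0] by simp

lemma anchor_derivation:
  assumes "u \<in> fibre E x" "smooth_fun (base E) f" "smooth_fun (base E) g"
  shows "anchor E x u (\<lambda>y. f y + g y) = anchor E x u f + anchor E x u g"
    and "anchor E x u (\<lambda>y. f y * g y) = anchor E x u f * g x + f x * anchor E x u g"
proof -
  have "anchor E x u \<in> tangent_vectors (base E) UNIV x"
    using anchor_axioms assms(1) unfolding is_anchor_def by (elim conjE) blast
  then have *: "(\<forall>a b. anchor E x u (\<lambda>y. a * f y + b * g y) = a * anchor E x u f + b * anchor E x u g) \<and>
      anchor E x u (\<lambda>y. f y * g y) = anchor E x u f * g x + f x * anchor E x u g"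
    using assms(2,3) unfolding tangent_vectors_def mem_Collect_eq by blast
  from *[THEN conjunct1, rule_format, of 1 1] *[THEN conjunct2]
  show "anchor E x u (\<lambda>y. f y + g y) = anchor E x u f + anchor E x u g"
    and "anchor E x u (\<lambda>y. f y * g y) = anchor E x u f * g x + f x * anchor E x u g"
    by simp_all
qed

lemma bracket_section: "\<psi> \<in> sections E \<Longrightarrow> \<phi> \<in> sections E \<Longrightarrow> br \<psi> \<phi> \<in> sections E"
  using algebroid unfolding courant_algebroid_def by (elim conjE) blast

lemma connection_section: "\<psi> \<in> sections E \<Longrightarrow> \<phi> \<in> sections E \<Longrightarrow> nab \<psi> \<phi> \<in> sections E"
  using connection unfolding courant_connection_def by (elim conjE) blast

lemma bracket_add:
  assumes "\<psi> \<in> sections E" "\<phi> \<in> sections E" "\<xi> \<in> sections E"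
  shows "br (\<lambda>x. \<psi> x + \<phi> x) \<xi> = (\<lambda>x. br \<psi> \<xi> x + br \<phi> \<xi> x)"
    and "br \<xi> (\<lambda>x. \<psi> x + \<phi> x) = (\<lambda>x. br \<xi> \<psi> x + br \<xi> \<phi> x)"
proof -
  have "\<forall>\<psi>\<in>sections E. \<forall>\<phi>\<in>sections E. \<forall>\<xi>\<in>sections E. \<forall>a b.
        br (\<lambda>x. a *\<^sub>R \<psi> x + b *\<^sub>R \<phi> x) \<xi> = (\<lambda>x. a *\<^sub>R br \<psi> \<xi> x + b *\<^sub>R br \<phi> \<xi> x) \<and>
        br \<xi> (\<lambda>x. a *\<^sub>R \<psi> x + b *\<^sub>R \<phi> x) = (\<lambda>x. a *\<^sub>R br \<xi> \<psi> x + b *\<^sub>R br \<xi> \<phi> x)"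
    using algebroid unfolding courant_algebroid_def by (elim conjE)
  from this[THEN bspec, OF assms(1), THEN bspec, OF assms(2), THEN bspec, OF assms(3),
      THEN spec, of 1, THEN spec, of 1]
  show "br (\<lambda>x. \<psi> x + \<phi> x) \<xi> = (\<lambda>x. br \<psi> \<xi> x + br \<phi> \<xi> x)"
    and "br \<xi> (\<lambda>x. \<psi> x + \<phi> x) = (\<lambda>x. br \<xi> \<psi> x + br \<xi> \<phi> x)" by simp_all
qed

lemma connection_add:
  assumes "\<psi> \<in> sections E" "\<phi> \<in> sections E" "\<xi> \<in> sections E"
  shows "nab (\<lambda>x. \<psi> x + \<phi> x) \<xi> = (\<lambda>x. nab \<psi> \<xi> x + nab \<phi> \<xi> x)"
    and "nab \<xi> (\<lambda>x. \<psi> x + \<phi> x) = (\<lambda>x. nab \<xi> \<psi> x + nab \<xi> \<phi> x)"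
proof -
  have "\<forall>\<psi>\<in>sections E. \<forall>\<phi>\<in>sections E. \<forall>\<xi>\<in>sections E. \<forall>a b.
        nab (\<lambda>x. a *\<^sub>R \<psi> x + b *\<^sub>R \<phi> x) \<xi> = (\<lambda>x. a *\<^sub>R nab \<psi> \<xi> x + b *\<^sub>R nab \<phi> \<xi> x) \<and>
        nab \<xi> (\<lambda>x. a *\<^sub>R \<psi> x + b *\<^sub>R \<phi> x) = (\<lambda>x. a *\<^sub>R nab \<xi> \<psi> x + b *\<^sub>R nab \<xi> \<phi> x)"
    using connection unfolding courant_connection_def by (elim conjE)
  from this[THEN bspec, OF assms(1), THEN bspec, OF assms(2), THEN bspec, OF assms(3),
      THEN spec, of 1, THEN spec, of 1]
  show "nab (\<lambda>x. \<psi> x + \<phi> x) \<xi> = (\<lambda>x. nab \<psi> \<xi> x + nab \<phi> \<xi> x)"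
    and "nab \<xi> (\<lambda>x. \<psi> x + \<phi> x) = (\<lambda>x. nab \<xi> \<psi> x + nab \<xi> \<phi> x)" by simp_all
qed

lemma connection_scale:
  assumes "\<psi> \<in> sections E" "\<phi> \<in> sections E" "smooth_fun (base E) f"
  shows "nab (\<lambda>x. f x *\<^sub>R \<psi> x) \<phi> = (\<lambda>x. f x *\<^sub>R nab \<psi> \<phi> x)"
    and "nab \<psi> (\<lambda>x. f x *\<^sub>R \<phi> x) = (\<lambda>x. f x *\<^sub>R nab \<psi> \<phi> x + anchor E x (\<psi> x) f *\<^sub>R \<phi> x)"
proof -
  have "\<forall>\<psi>\<in>sections E. \<forall>\<phi>\<in>sections E. \<forall>f. smooth_fun (base E) f \<longrightarrow>
        nab (\<lambda>x. f x *\<^sub>R \<psi> x) \<phi> = (\<lambda>x. f x *\<^sub>R nab \<psi> \<phi> x) \<and>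
        nab \<psi> (\<lambda>x. f x *\<^sub>R \<phi> x) = (\<lambda>x. f x *\<^sub>R nab \<psi> \<phi> x + anchor E x (\<psi> x) f *\<^sub>R \<phi> x)"
    using connection unfolding courant_connection_def by (elim conjE)
  from this[THEN bspec, OF assms(1), THEN bspec, OF assms(2), THEN spec, THEN mp, OF assms(3)]
  show "nab (\<lambda>x. f x *\<^sub>R \<psi> x) \<phi> = (\<lambda>x. f x *\<^sub>R nab \<psi> \<phi> x)"
    and "nab \<psi> (\<lambda>x. f x *\<^sub>R \<phi> x) = (\<lambda>x. f x *\<^sub>R nab \<psi> \<phi> x + anchor E x (\<psi> x) f *\<^sub>R \<phi> x)"
    by blast+
qed

lemma bracket_scale_right:
  assumes "\<psi> \<in> sections E" "\<phi> \<in> sections E" "smooth_fun (base E) f"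
  shows "br \<psi> (\<lambda>x. f x *\<^sub>R \<phi> x) = (\<lambda>x. f x *\<^sub>R br \<psi> \<phi> x + anchor E x (\<psi> x) f *\<^sub>R \<phi> x)"
proof -
  have "\<forall>\<psi>\<in>sections E. \<forall>\<phi>\<in>sections E. \<forall>f. smooth_fun (base E) f \<longrightarrow>
        br \<psi> (\<lambda>x. f x *\<^sub>R \<phi> x) = (\<lambda>x. f x *\<^sub>R br \<psi> \<phi> x + anchor E x (\<psi> x) f *\<^sub>R \<phi> x)"
    using algebroid unfolding courant_algebroid_def by (elim conjE)
  from this[THEN bspec, OF assms(1), THEN bspec, OF assms(2), THEN spec, THEN mp, OF assms(3)]
  show ?thesis .
qed

lemma bracket_self:
  assumes "\<psi> \<in> sections E" "\<xi> \<in> sections E"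
  shows "metric E x (br \<psi> \<psi> x) (\<xi> x) = 1 / 2 * anchor E x (\<xi> x) (\<lambda>y. metric E y (\<psi> y) (\<psi> y))"
  using algebroid assms unfolding courant_algebroid_def by (elim conjE) blast

text \<open>The polarisation of the axiom for the square \<open>br \<psi> \<psi>\<close>.\<close>

lemma bracket_symmetric_part:
  assumes \<psi>: "\<psi> \<in> sections E" and \<phi>: "\<phi> \<in> sections E" and \<xi>: "\<xi> \<in> sections E"
  shows "metric E x (br \<psi> \<phi> x) (\<xi> x) + metric E x (br \<phi> \<psi> x) (\<xi> x) =
    anchor E x (\<xi> x) (\<lambda>y. metric E y (\<psi> y) (\<phi> y))"
proof -
  let ?\<sigma> = "\<lambda>x. \<psi> x + \<phi> x"
  note sec = sections_add[OF \<psi> \<phi>] and fib = sections_fibre[OF \<psi>] sections_fibre[OF \<phi>] sections_fibre[OF \<xi>]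
  note br_fib = bracket_section[THEN sections_fibre]
  have "metric E x (br ?\<sigma> ?\<sigma> x) (\<xi> x) =
      metric E x (br \<psi> \<psi> x) (\<xi> x) + metric E x (br \<phi> \<phi> x) (\<xi> x) +
      (metric E x (br \<psi> \<phi> x) (\<xi> x) + metric E x (br \<phi> \<psi> x) (\<xi> x))"
    using \<psi> \<phi> \<xi> sec fib br_fib
    by (simp add: bracket_add metric_add_left subspace_add[OF fibre_subspace])
  moreover have "anchor E x (\<xi> x) (\<lambda>y. metric E y (?\<sigma> y) (?\<sigma> y)) =
      anchor E x (\<xi> x) (\<lambda>y. metric E y (\<psi> y) (\<psi> y)) + anchor E x (\<xi> x) (\<lambda>y. metric E y (\<phi> y) (\<phi> y)) +
      2 * anchor E x (\<xi> x) (\<lambda>y. metric E y (\<psi> y) (\<phi> y))"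
  proof -
    have "(\<lambda>y. metric E y (?\<sigma> y) (?\<sigma> y)) = (\<lambda>y. (metric E y (\<psi> y) (\<psi> y) + metric E y (\<phi> y) (\<phi> y)) +
        (metric E y (\<psi> y) (\<phi> y) + metric E y (\<psi> y) (\<phi> y)))"
      using fib metric_sym[OF fib(2,1)]
      by (intro ext) (simp add: metric_add_left metric_add_right subspace_add[OF fibre_subspace])
    then show ?thesis
      by (simp only: mult_2 anchor_derivation(1) smooth_fun_on_add manifold metric_smooth \<psi> \<phi> fib)
  qed
  ultimately show ?thesis
    using bracket_self[OF sec \<xi>, of x] bracket_self[OF \<psi> \<xi>, of x] bracket_self[OF \<phi> \<xi>, of x] by simp
qed

text \<open>The Leibniz rule in the first argument, obtained from the one in the second argument by exchanging
  the arguments. The exchange produces a derivative of \<open>f\<close> along the third section \<open>\<xi>\<close>, which is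
  the reason for the last term in the definition of the torsion form.\<close>

lemma bracket_scale_left:
  assumes \<psi>: "\<psi> \<in> sections E" and \<phi>: "\<phi> \<in> sections E" and \<xi>: "\<xi> \<in> sections E"
    and f: "smooth_fun (base E) f"
  shows "metric E x (br (\<lambda>x. f x *\<^sub>R \<psi> x) \<phi> x) (\<xi> x) =
    f x * metric E x (br \<psi> \<phi> x) (\<xi> x) - anchor E x (\<phi> x) f * metric E x (\<psi> x) (\<xi> x)
    + anchor E x (\<xi> x) f * metric E x (\<psi> x) (\<phi> x)"
proof -
  note fib = sections_fibre[OF \<psi>] sections_fibre[OF \<phi>] sections_fibre[OF \<xi>]
    sections_fibre[OF bracket_section[OF \<phi> \<psi>]]
  have "(\<lambda>y. metric E y (f y *\<^sub>R \<psi> y) (\<phi> y)) = (\<lambda>y. f y * metric E y (\<psi> y) (\<phi> y))"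
    using fib by (simp add: metric_scale_left)
  moreover have "metric E x (br \<phi> (\<lambda>x. f x *\<^sub>R \<psi> x) x) (\<xi> x) =
      f x * metric E x (br \<phi> \<psi> x) (\<xi> x) + anchor E x (\<phi> x) f * metric E x (\<psi> x) (\<xi> x)"
    using fib by (simp add: bracket_scale_right[OF \<phi> \<psi> f] metric_lincomb_left)
  ultimately show ?thesis
    using bracket_symmetric_part[OF sections_scale[OF \<psi> f] \<phi> \<xi>, of x]
      anchor_derivation(2)[OF fib(3)[of x] f metric_smooth[OF \<psi> \<phi>]]
    by (simp add: bracket_symmetric_part[OF \<psi> \<phi> \<xi>, symmetric] algebra_simps)
qed

abbreviation "torsion \<equiv> torsion_form E br nab"

lemma torsion_expand:
  assumes \<psi>: "\<psi> \<in> sections E" and \<phi>: "\<phi> \<in> sections E" and \<xi>: "\<xi> \<in> sections E"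
  shows "torsion \<psi> \<phi> \<xi> x = metric E x (nab \<psi> \<phi> x) (\<xi> x) - metric E x (nab \<phi> \<psi> x) (\<xi> x)
    - metric E x (br \<psi> \<phi> x) (\<xi> x) + metric E x (nab \<xi> \<psi> x) (\<phi> x)"
proof -
  have "nab \<psi> \<phi> x \<in> fibre E x" "nab \<phi> \<psi> x \<in> fibre E x" "br \<psi> \<phi> x \<in> fibre E x" "\<xi> x \<in> fibre E x"
    using assms by (auto intro: sections_fibre connection_section bracket_section)
  then show ?thesis
    by (simp add: torsion_form_def metric_diff_left subspace_diff[OF fibre_subspace])
qed

lemma torsion_add:
  assumes \<psi>: "\<psi> \<in> sections E" and \<psi>': "\<psi>' \<in> sections E" and \<phi>: "\<phi> \<in> sections E" and \<xi>: "\<xi> \<in> sections E"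
  shows "torsion (\<lambda>x. \<psi> x + \<psi>' x) \<phi> \<xi> x = torsion \<psi> \<phi> \<xi> x + torsion \<psi>' \<phi> \<xi> x"
    and "torsion \<phi> (\<lambda>x. \<psi> x + \<psi>' x) \<xi> x = torsion \<phi> \<psi> \<xi> x + torsion \<phi> \<psi>' \<xi> x"
    and "torsion \<phi> \<xi> (\<lambda>x. \<psi> x + \<psi>' x) x = torsion \<phi> \<xi> \<psi> x + torsion \<phi> \<xi> \<psi>' x"
  using assms
  by (simp_all add: torsion_expand sections_add connection_add bracket_add metric_add_left metric_add_right
      sections_fibre connection_section bracket_section)

text \<open>The derivatives of \<open>f\<close> cancel: in the second argument those from \<open>nab \<psi> \<phi>\<close> and from the bracket, in
  the first argument those along \<open>\<phi>\<close> from \<open>nab \<phi> \<psi>\<close> and from the bracket, and those along \<open>\<xi>\<close> from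
  the bracket and from \<open>nab \<xi> \<psi>\<close>.\<close>

lemma torsion_scale:
  assumes \<psi>: "\<psi> \<in> sections E" and \<phi>: "\<phi> \<in> sections E" and \<xi>: "\<xi> \<in> sections E"
    and f: "smooth_fun (base E) f"
  shows "torsion (\<lambda>x. f x *\<^sub>R \<psi> x) \<phi> \<xi> x = f x * torsion \<psi> \<phi> \<xi> x"
    and "torsion \<psi> (\<lambda>x. f x *\<^sub>R \<phi> x) \<xi> x = f x * torsion \<psi> \<phi> \<xi> x"
    and "torsion \<psi> \<phi> (\<lambda>x. f x *\<^sub>R \<xi> x) x = f x * torsion \<psi> \<phi> \<xi> x"
  using assms
  by (simp_all add: torsion_expand sections_scale connection_scale bracket_scale_right bracket_scale_left
      metric_lincomb_left metric_scale_left metric_scale_right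
      sections_fibre connection_section bracket_section algebra_simps)

lemma torsion_pointwise:
  assumes "\<psi> \<in> sections E" "\<phi> \<in> sections E" "\<xi> \<in> sections E"
    and "\<psi>' \<in> sections E" "\<phi>' \<in> sections E" "\<xi>' \<in> sections E"
    and "\<psi> x = \<psi>' x" "\<phi> x = \<phi>' x" "\<xi> x = \<xi>' x"
  shows "torsion \<psi> \<phi> \<xi> x = torsion \<psi>' \<phi>' \<xi>' x"
proof -
  have "torsion \<psi> \<phi> \<xi> x = torsion \<psi>' \<phi> \<xi> x"
    using assms by (intro pointwise_if_Cinf_linear[where F = "\<lambda>\<psi>. torsion \<psi> \<phi> \<xi> x" and x = x] torsion_add torsion_scale)
  also have "\<dots> = torsion \<psi>' \<phi>' \<xi> x"
    using assms by (intro pointwise_if_Cinf_linear[where F = "\<lambda>\<phi>. torsion \<psi>' \<phi> \<xi> x" and x = x] torsion_add torsion_scale)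
  also have "\<dots> = torsion \<psi>' \<phi>' \<xi>' x"
    using assms by (intro pointwise_if_Cinf_linear[where F = "\<lambda>\<xi>. torsion \<psi>' \<phi>' \<xi> x" and x = x] torsion_add torsion_scale)
  finally show ?thesis .
qed

text \<open>Tensoriality makes the value unique, so that the definite description in \<open>tensor_of\<close> denotes it.\<close>

lemma torsion_tensor:
  assumes "\<psi> \<in> sections E" "\<phi> \<in> sections E" "\<xi> \<in> sections E"
  shows "tensor_of E torsion x (\<psi> x) (\<phi> x) (\<xi> x) = torsion \<psi> \<phi> \<xi> x"
  unfolding tensor_of_def
proof (rule the_equality)
  show "\<forall>\<psi>'\<in>sections E. \<forall>\<phi>'\<in>sections E. \<forall>\<xi>'\<in>sections E.
      \<psi>' x = \<psi> x \<longrightarrow> \<phi>' x = \<phi> x \<longrightarrow> \<xi>' x = \<xi> x \<longrightarrow> torsion \<psi>' \<phi>' \<xi>' x = torsion \<psi> \<phi> \<xi> x"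
    using assms by (intro ballI impI torsion_pointwise)
qed (use assms in blast)

lemma torsion_vanishes:
  assumes inv: "involutive_structure E br S L"
    and nab: "\<And>\<psi> \<phi>. \<psi> \<in> sections_in E S L \<Longrightarrow> \<phi> \<in> sections_in E S L \<Longrightarrow> nab \<psi> \<phi> \<in> sections_in E S L"
    and sec: "\<psi> \<in> sections_in E S L" "\<phi> \<in> sections_in E S L" "\<xi> \<in> sections_in E S L" and x: "x \<in> S"
  shows "torsion \<psi> \<phi> \<xi> x = 0"
proof -
  have isotropic: "metric E x u v = 0" if "u \<in> L x" "v \<in> L x" for u v
    using inv x that unfolding involutive_structure_def orthogonal_complement_def by blast
  have br: "br \<psi> \<phi> \<in> sections_in E S L"
    using inv sec(1,2) unfolding involutive_structure_def by blast
  have "\<sigma> x \<in> L x" if "\<sigma> \<in> sections_in E S L" for \<sigma>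
    using that x by (simp add: sections_in_def)
  moreover have "\<sigma> \<in> sections E" if "\<sigma> \<in> sections_in E S L" for \<sigma>
    using that by (simp add: sections_in_def)
  ultimately show ?thesis
    using sec nab br by (simp add: torsion_expand isotropic)
qed

end

section \<open>Products and relations\<close>

lemma smooth_fun_on_fst:
  assumes M: "smooth_manifold M" and MN: "smooth_manifold (product_structure M N)"
    and f: "smooth_fun_on M A f"
  shows "smooth_fun_on (product_structure M N) (A \<times> B) (\<lambda>p. f (fst p))"
proof (rule smooth_fun_onI[OF MN])
  fix P \<theta> p
  assume P: "(P, \<theta>) \<in> atlas (product_structure M N)" and p: "p \<in> A \<times> B" "p \<in> P"
  obtain U \<phi> V \<psi> where U: "(U, \<phi>) \<in> atlas M" and P_eq: "P = U \<times> V" "\<theta> = map_prod \<phi> \<psi>"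
    using P by (auto simp: product_structure_def)
  have p': "fst p \<in> A" "fst p \<in> U" using p P_eq(1) by auto
  obtain G g where G: "open G" "\<phi> (fst p) \<in> G" "Cinf_on G g"
    and g: "\<And>q. q \<in> A \<Longrightarrow> q \<in> U \<Longrightarrow> \<phi> q \<in> G \<Longrightarrow> g (\<phi> q) = f q"
    using smooth_fun_onD[OF M f U, of "fst p"] p' by blast
  have open': "open (G \<times> UNIV)" using G(1) by (intro open_Times open_UNIV)
  have "Cinf_on (G \<times> UNIV) (\<lambda>z. g (fst z))"
    by (rule Cinf_on_compose[OF open' G(1) _ Cinf_on_bounded_linear[OF bounded_linear_fst open'] G(3)]) auto
  then show "\<exists>H h. open H \<and> \<theta> p \<in> H \<and> Cinf_on H h \<and>
      (\<forall>q\<in>A \<times> B \<inter> P. \<theta> q \<in> H \<longrightarrow> h (\<theta> q) = f (fst q))"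
    using open' G(2) P_eq
    by (intro smooth_extensionI[where G = "G \<times> UNIV" and g = "\<lambda>z. g (fst z)"])
      (auto simp: g map_prod_def split_beta)
qed

lemma smooth_fun_on_snd:
  assumes N: "smooth_manifold N" and MN: "smooth_manifold (product_structure M N)"
    and f: "smooth_fun_on N B f"
  shows "smooth_fun_on (product_structure M N) (A \<times> B) (\<lambda>p. f (snd p))"
proof (rule smooth_fun_onI[OF MN])
  fix P \<theta> p
  assume P: "(P, \<theta>) \<in> atlas (product_structure M N)" and p: "p \<in> A \<times> B" "p \<in> P"
  obtain U \<phi> V \<psi> where V: "(V, \<psi>) \<in> atlas N" and P_eq: "P = U \<times> V" "\<theta> = map_prod \<phi> \<psi>"
    using P by (auto simp: product_structure_def)
  have p': "snd p \<in> B" "snd p \<in> V" using p P_eq(1) by auto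
  obtain G g where G: "open G" "\<psi> (snd p) \<in> G" "Cinf_on G g"
    and g: "\<And>q. q \<in> B \<Longrightarrow> q \<in> V \<Longrightarrow> \<psi> q \<in> G \<Longrightarrow> g (\<psi> q) = f q"
    using smooth_fun_onD[OF N f V, of "snd p"] p' by blast
  have open': "open (UNIV \<times> G)" using G(1) by (intro open_Times open_UNIV)
  have "Cinf_on (UNIV \<times> G) (\<lambda>z. g (snd z))"
    by (rule Cinf_on_compose[OF open' G(1) _ Cinf_on_bounded_linear[OF bounded_linear_snd open'] G(3)]) auto
  then show "\<exists>H h. open H \<and> \<theta> p \<in> H \<and> Cinf_on H h \<and>
      (\<forall>q\<in>A \<times> B \<inter> P. \<theta> q \<in> H \<longrightarrow> h (\<theta> q) = f (snd q))"
    using open' G(2) P_eq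
    by (intro smooth_extensionI[where G = "UNIV \<times> G" and g = "\<lambda>z. g (snd z)"])
      (auto simp: g map_prod_def split_beta)
qed

text \<open>In a product frame the coefficients of the pair are those of the two sections, pulled back along
  the projections.\<close>

lemma section_pair_in_sections:
  fixes E :: "('a::{t2_space, second_countable_topology}, 'e::euclidean_space, 'v::real_vector) metric_bundle"
    and F :: "('b::{t2_space, second_countable_topology}, 'f::euclidean_space, 'w::real_vector) metric_bundle"
  assumes E: "smooth_vector_bundle E" and F: "smooth_vector_bundle F"
    and EF: "smooth_vector_bundle (product_bundle E F)"
    and \<psi>: "\<psi>1 \<in> sections E" "\<psi>2 \<in> sections F"
  shows "section_pair \<psi>1 \<psi>2 \<in> sections (product_bundle E F)"
proof -
  interpret E: smooth_vector_bundle E by (rule E)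
  interpret F: smooth_vector_bundle F by (rule F)
  interpret EF: smooth_vector_bundle "product_bundle E F" by (rule EF)
  have base_EF: "base (product_bundle E F) = product_structure (base E) (base F)"
    and rank_EF: "bundle_rank (product_bundle E F) = bundle_rank E + bundle_rank F"
    by (simp_all add: product_bundle_def)
  have "smooth_section_on (product_bundle E F) UNIV (section_pair \<psi>1 \<psi>2)"
  proof (rule EF.smooth_section_onI_local)
    fix p :: "'a \<times> 'b"
    obtain U s where U: "(U, s) \<in> local_frames E" "fst p \<in> U" by (rule E.frame_covers)
    obtain V t where V: "(V, t) \<in> local_frames F" "snd p \<in> V" by (rule F.frame_covers)
    obtain c where c: "\<And>i. i < bundle_rank E \<Longrightarrow> smooth_fun_on (base E) (UNIV \<inter> U) (c i)"
      "\<And>x. x \<in> UNIV \<Longrightarrow> x \<in> U \<Longrightarrow> \<psi>1 x = (\<Sum>i<bundle_rank E. c i x *\<^sub>R s i x)"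
      using \<psi>(1) E.smooth_section_onD[OF _ U(1)] unfolding sections_def by blast
    obtain d where d: "\<And>i. i < bundle_rank F \<Longrightarrow> smooth_fun_on (base F) (UNIV \<inter> V) (d i)"
      "\<And>y. y \<in> UNIV \<Longrightarrow> y \<in> V \<Longrightarrow> \<psi>2 y = (\<Sum>i<bundle_rank F. d i y *\<^sub>R t i y)"
      using \<psi>(2) F.smooth_section_onD[OF _ V(1)] unfolding sections_def by blast
    let ?r = "bundle_rank E" and ?r' = "bundle_rank F"
    define st where "st i = (\<lambda>(x, y). if i < ?r then (s i x, 0) else (0, t (i - ?r) y))" for i
    define cd where "cd i q = (if i < ?r then c i (fst q) else d (i - ?r) (snd q))" for i q
    have frame: "(U \<times> V, st) \<in> local_frames (product_bundle E F)"
      using U(1) V(1) by (auto simp: product_bundle_def st_def[abs_def])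
    have smooth: "smooth_fun_on (product_structure (base E) (base F)) (U \<times> V) (cd i)" if "i < ?r + ?r'" for i
    proof (cases "i < ?r")
      case True
      then show ?thesis
        using smooth_fun_on_fst[OF E.manifold EF.manifold[unfolded base_EF] c(1)[OF True], of V] True
        by (simp add: cd_def[abs_def])
    next
      case False
      then have "i - ?r < ?r'" using that by simp
      from smooth_fun_on_snd[OF F.manifold EF.manifold[unfolded base_EF] d(1)[OF this], of U] False
      show ?thesis by (simp add: cd_def[abs_def])
    qed
    have eq: "section_pair \<psi>1 \<psi>2 q = (\<Sum>i<?r + ?r'. cd i q *\<^sub>R st i q)" if q: "q \<in> U \<times> V" for q
    proof -
      have split_sum: "(\<Sum>i<m + n. f i) = (\<Sum>i<m. f i) + (\<Sum>i<n. f (m + i))"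
        for m n and f :: "nat \<Rightarrow> 'v \<times> 'w"
        by (induction n) (simp_all add: add.assoc)
      have "(\<Sum>i<?r + ?r'. cd i q *\<^sub>R st i q) =
          (\<Sum>i<?r. cd i q *\<^sub>R st i q) + (\<Sum>i<?r'. cd (?r + i) q *\<^sub>R st (?r + i) q)"
        by (rule split_sum)
      also have "(\<Sum>i<?r. cd i q *\<^sub>R st i q) = (\<Sum>i<?r. (c i (fst q) *\<^sub>R s i (fst q), 0))"
        by (intro sum.cong) (auto simp: cd_def st_def split_beta)
      also have "(\<Sum>i<?r'. cd (?r + i) q *\<^sub>R st (?r + i) q) = (\<Sum>i<?r'. (0, d i (snd q) *\<^sub>R t i (snd q)))"
        by (intro sum.cong) (auto simp: cd_def st_def split_beta)
      finally show ?thesis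
        using q c(2)[of "fst q"] d(2)[of "snd q"]
        by (auto simp: section_pair_def sum_prod split_beta)
    qed
    show "\<exists>W V t c. open W \<and> p \<in> W \<and> (V, t) \<in> local_frames (product_bundle E F) \<and> W \<subseteq> V \<and>
      (\<forall>i<bundle_rank (product_bundle E F). smooth_fun_on (base (product_bundle E F)) (UNIV \<inter> W) (c i)) \<and>
      (\<forall>x\<in>UNIV \<inter> W. section_pair \<psi>1 \<psi>2 x = (\<Sum>i<bundle_rank (product_bundle E F). c i x *\<^sub>R t i x))"
      unfolding base_EF rank_EF
    proof (intro exI conjI)
      show "open (U \<times> V)" using E.frame_open[OF U(1)] F.frame_open[OF V(1)] by (rule open_Times)
      show "p \<in> U \<times> V" using U(2) V(2) by (simp add: mem_Times_iff)
      show "(U \<times> V, st) \<in> local_frames (product_bundle E F)" by (rule frame)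
      show "\<forall>i<?r + ?r'. smooth_fun_on (product_structure (base E) (base F)) (UNIV \<inter> U \<times> V) (cd i)"
        using smooth by simp
      show "\<forall>x\<in>UNIV \<inter> U \<times> V. section_pair \<psi>1 \<psi>2 x = (\<Sum>i<?r + ?r'. cd i x *\<^sub>R st i x)"
        using eq by simp
    qed simp
  qed
  then show ?thesis by (simp add: sections_def)
qed

lemma sections_opposite: "sections (opposite E) = sections E"
  by (simp add: sections_def smooth_section_on_def opposite_def)

lemma smooth_vector_bundle_opposite:
  "smooth_vector_bundle E \<Longrightarrow> smooth_vector_bundle (opposite E)"
  by (simp add: smooth_vector_bundle_def vector_bundle_def opposite_def)

lemma torsion_form_section_pair:
  assumes br: "is_product_bracket E1 br1 (opposite E2) br2 br"
    and nab: "is_product_connection E1 nab1 (opposite E2) nab2 nab"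
    and sec1: "\<psi>1 \<in> sections E1" "\<phi>1 \<in> sections E1" "\<xi>1 \<in> sections E1"
    and sec2: "\<psi>2 \<in> sections E2" "\<phi>2 \<in> sections E2" "\<xi>2 \<in> sections E2"
  shows "torsion_form (product_bundle E1 (opposite E2)) br nab
      (section_pair \<psi>1 \<psi>2) (section_pair \<phi>1 \<phi>2) (section_pair \<xi>1 \<xi>2) (x, y) =
    torsion_form E1 br1 nab1 \<psi>1 \<phi>1 \<xi>1 x - torsion_form E2 br2 nab2 \<psi>2 \<phi>2 \<xi>2 y"
proof -
  have "br (section_pair \<psi>1 \<psi>2) (section_pair \<phi>1 \<phi>2) = section_pair (br1 \<psi>1 \<phi>1) (br2 \<psi>2 \<phi>2)"
    using br sec1 sec2 by (simp add: is_product_bracket_def sections_opposite)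
  moreover have "nab (section_pair \<alpha>1 \<alpha>2) (section_pair \<beta>1 \<beta>2) = section_pair (nab1 \<alpha>1 \<beta>1) (nab2 \<alpha>2 \<beta>2)"
    if "\<alpha>1 \<in> sections E1" "\<alpha>2 \<in> sections E2" "\<beta>1 \<in> sections E1" "\<beta>2 \<in> sections E2" for \<alpha>1 \<alpha>2 \<beta>1 \<beta>2
    using nab that by (simp add: is_product_connection_def sections_opposite)
  ultimately show ?thesis
    using sec1 sec2
    by (simp add: torsion_form_def section_pair_def product_bundle_def opposite_def)
qed

theorem proposition6p6:
  fixes E1 :: "('a::{t2_space, second_countable_topology}, 'e::euclidean_space, 'v::real_vector) metric_bundle"
    and E2 :: "('b::{t2_space, second_countable_topology}, 'f::euclidean_space, 'w::real_vector) metric_bundle"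
    and br1 nab1 :: "('a \<Rightarrow> 'v) \<Rightarrow> ('a \<Rightarrow> 'v) \<Rightarrow> 'a \<Rightarrow> 'v"
    and br2 nab2 :: "('b \<Rightarrow> 'w) \<Rightarrow> ('b \<Rightarrow> 'w) \<Rightarrow> 'b \<Rightarrow> 'w"
    and S :: "('a \<times> 'b) set"
    and R :: "'a \<times> 'b \<Rightarrow> ('v \<times> 'w) set"
  assumes "courant_algebroid E1 br1" and "courant_connection E1 nab1"
    and "courant_algebroid E2 br2" and "courant_connection E2 nab2"
    and "courant_relation E1 br1 E2 br2 S R"
    and "connections_related E1 nab1 E2 nab2 S R"
  shows "tensors_related S R
           (tensor_of E1 (torsion_form E1 br1 nab1)) (tensor_of E2 (torsion_form E2 br2 nab2))"
proof -
  let ?P = "product_bundle E1 (opposite E2)"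
  interpret E1: courant_algebroid_connection E1 br1 nab1
    using assms(1,2) by unfold_locales
  interpret E2: courant_algebroid_connection E2 br2 nab2
    using assms(3,4) by unfold_locales
  obtain br where br: "is_product_bracket E1 br1 (opposite E2) br2 br"
    and inv: "involutive_structure ?P br S R"
    using assms(5) unfolding courant_relation_def by blast
  obtain nab where nab: "is_product_connection E1 nab1 (opposite E2) nab2 nab"
    and nab_R: "\<And>\<psi> \<phi>. \<psi> \<in> sections_in ?P S R \<Longrightarrow> \<phi> \<in> sections_in ?P S R \<Longrightarrow> nab \<psi> \<phi> \<in> sections_in ?P S R"
    using assms(6) unfolding connections_related_def by blast
  interpret P: courant_algebroid_connection ?P br nab
    using br nab by unfold_locales (simp_all add: is_product_bracket_def is_product_connection_def)
  have pair: "section_pair \<psi>1 \<psi>2 \<in> sections ?P" if "\<psi>1 \<in> sections E1" "\<psi>2 \<in> sections E2" for \<psi>1 \<psi>2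
    using section_pair_in_sections[OF E1.smooth_vector_bundle_axioms
        smooth_vector_bundle_opposite[OF E2.smooth_vector_bundle_axioms] P.smooth_vector_bundle_axioms] that
    by (simp add: sections_opposite)
  have R_fibre: "u \<in> fibre E1 x \<and> u' \<in> fibre E2 y" if "(x, y) \<in> S" "(u, u') \<in> R (x, y)" for x y u u'
  proof -
    have "(u, u') \<in> orthogonal_complement ?P R (x, y)"
      using inv that unfolding involutive_structure_def by blast
    then show ?thesis by (simp add: orthogonal_complement_def product_bundle_def opposite_def)
  qed
  have extend: "\<exists>\<psi>1\<in>sections E1. \<exists>\<psi>2\<in>sections E2. \<exists>\<psi>\<in>sections_in ?P S R.
      \<psi>1 x = u \<and> \<psi>2 y = u' \<and> \<psi> (x, y) = section_pair \<psi>1 \<psi>2 (x, y)"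
    if S: "(x, y) \<in> S" and u: "(u, u') \<in> R (x, y)" for x y u u'
  proof -
    obtain \<psi>1 where "\<psi>1 \<in> sections E1" "\<psi>1 x = u"
      using E1.section_through R_fibre[OF S u] by blast
    moreover obtain \<psi>2 where "\<psi>2 \<in> sections E2" "\<psi>2 y = u'"
      using E2.section_through R_fibre[OF S u] by blast
    moreover have sub: "subbundle ?P S R" using inv by (simp add: involutive_structure_def)
    obtain \<psi> where "\<psi> \<in> sections_in ?P S R" "\<psi> (x, y) = (u, u')"
      by (rule P.section_in_subbundle[where x = "(x, y)" and v = "(u, u')", OF sub S u])
    ultimately show ?thesis by (auto simp: section_pair_def)
  qed
  have "tensor_of E1 E1.torsion x u v w = tensor_of E2 E2.torsion y u' v' w'"
    if S: "(x, y) \<in> S" and u: "(u, u') \<in> R (x, y)" and v: "(v, v') \<in> R (x, y)" and w: "(w, w') \<in> R (x, y)"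
    for x y u u' v v' w w'
  proof -
    obtain \<psi>1 \<psi>2 \<psi> where \<psi>: "\<psi>1 \<in> sections E1" "\<psi>2 \<in> sections E2" "\<psi> \<in> sections_in ?P S R"
      "\<psi>1 x = u" "\<psi>2 y = u'" "\<psi> (x, y) = section_pair \<psi>1 \<psi>2 (x, y)"
      using extend[OF S u] by blast
    obtain \<phi>1 \<phi>2 \<phi> where \<phi>: "\<phi>1 \<in> sections E1" "\<phi>2 \<in> sections E2" "\<phi> \<in> sections_in ?P S R"
      "\<phi>1 x = v" "\<phi>2 y = v'" "\<phi> (x, y) = section_pair \<phi>1 \<phi>2 (x, y)"
      using extend[OF S v] by blast
    obtain \<xi>1 \<xi>2 \<xi> where \<xi>: "\<xi>1 \<in> sections E1" "\<xi>2 \<in> sections E2" "\<xi> \<in> sections_in ?P S R"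
      "\<xi>1 x = w" "\<xi>2 y = w'" "\<xi> (x, y) = section_pair \<xi>1 \<xi>2 (x, y)"
      using extend[OF S w] by blast
    have sec: "\<sigma> \<in> sections ?P" if "\<sigma> \<in> sections_in ?P S R" for \<sigma>
      using that by (simp add: sections_in_def)
    have "E1.torsion \<psi>1 \<phi>1 \<xi>1 x - E2.torsion \<psi>2 \<phi>2 \<xi>2 y =
        P.torsion (section_pair \<psi>1 \<psi>2) (section_pair \<phi>1 \<phi>2) (section_pair \<xi>1 \<xi>2) (x, y)"
      by (rule torsion_form_section_pair[OF br nab \<psi>(1) \<phi>(1) \<xi>(1) \<psi>(2) \<phi>(2) \<xi>(2), symmetric])
    also have "\<dots> = P.torsion \<psi> \<phi> \<xi> (x, y)"
      by (rule P.torsion_pointwise[OF pair[OF \<psi>(1,2)] pair[OF \<phi>(1,2)] pair[OF \<xi>(1,2)]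
          sec[OF \<psi>(3)] sec[OF \<phi>(3)] sec[OF \<xi>(3)] \<psi>(6)[symmetric] \<phi>(6)[symmetric] \<xi>(6)[symmetric]])
    also have "\<dots> = 0"
      by (rule P.torsion_vanishes[OF inv nab_R \<psi>(3) \<phi>(3) \<xi>(3) S])
    finally show ?thesis
      using E1.torsion_tensor[OF \<psi>(1) \<phi>(1) \<xi>(1), of x] E2.torsion_tensor[OF \<psi>(2) \<phi>(2) \<xi>(2), of y]
        \<psi>(4,5) \<phi>(4,5) \<xi>(4,5) by simp
  qed
  then show ?thesis unfolding tensors_related_def by fast
qed

end
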